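(* Let $\mathbb{K}$ be a field of characteristic $2$, let $\alpha \in \mathbb{K}\setminus\{0\}$, let $E$ be a vector space over $\mathbb{K}$ of finite dimension $n \geq 1$, and let $u \in \operatorname{End}(E)$. Then $u$ is an $(\alpha,-\alpha)$-composite (in $\operatorname{End}(E)$) if and only if the elementary factors of $u_{-\{0,\alpha\}}$ are even polynomials (i.e. polynomials of $X^2$).
   Context: For scalars $a,b \in \mathbb{K}\setminus\{0\}$, an element $x$ of a $\mathbb{K}$-algebra $\mathcal{A}$ is an $(a,b)$-composite if there are idempotents $p,q \in \mathcal{A}$ (i.e. $p^2=p$, $q^2=q$) with $x = a p + b q$. For a subset $\Lambda\subset\mathbb{K}$, write the minimal polynomial of $u$ as $\mu_u = P Q$ with $P$ a product of (possibly repeated) factors $X-\lambda$, $\lambda\in\Lambda$, and $Q$ monic with no root in $\Lambda$; then $u_{-\Lambda}$ denotes the endomorphism of $\operatorname{Ker} Q(u)$ induced by $u$. The elementary factors of an endomorphism (or square matrix) are its invariant factors: the nonconstant monic polynomials $P_1 \mid P_2 \mid \dots \mid P_N$ in $\mathbb{K}[X]$ such that it is represented by (similar to) the block-diagonal matrix of the companion matrices of $P_1,\dots,P_N$ (there are none if the space is zero). A polynomial of $X^2$ is a polynomial of the form $S(X^2)$ with $S\in\mathbb{K}[X]$. *)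

theory Defs
  imports
    "HOL-Computational_Algebra.Computational_Algebra"
    "Jordan_Normal_Form.Matrix"
begin

text \<open>Column \<open>j\<close> is the image of the \<open>j\<close>-th basis vector: ones below the diagonal, and
  the negated non-leading coefficients of \<open>P\<close> in the last column.\<close>

definition companion_mat :: "'k::field poly \<Rightarrow> 'k mat" where
  "companion_mat P = mat (degree P) (degree P)
     (\<lambda>(i, j). if i = Suc j then 1 else if Suc j = degree P then - coeff P i else 0)"

definition even_poly :: "'k::field poly \<Rightarrow> bool" where
  "even_poly P \<longleftrightarrow> (\<exists>S. P = pcompose S (monom 1 2))"

definition remove_roots :: "'k::field set \<Rightarrow> 'k poly \<Rightarrow> 'k poly" where
  "remove_roots \<Lambda> f = (THE Q. lead_coeff Q = 1 \<and> (\<forall>c\<in>\<Lambda>. poly Q c \<noteq> 0) \<and>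
     (\<exists>M. set_mset M \<subseteq> \<Lambda> \<and> f = (\<Prod>c\<in>#M. [:- c, 1:]) * Q))"

text \<open>In what follows \<open>s\<close> is the scalar multiplication of a \<open>'k\<close>-vector space whose set of
  vectors is the whole type \<open>'v\<close>.\<close>

definition composite ::
    "('k::field \<Rightarrow> 'v::ab_group_add \<Rightarrow> 'v) \<Rightarrow> 'k \<Rightarrow> 'k \<Rightarrow> ('v \<Rightarrow> 'v) \<Rightarrow> bool" where
  "composite s a b u \<longleftrightarrow> (\<exists>p q.
     Vector_Spaces.linear s s p \<and> p \<circ> p = p \<and>
     Vector_Spaces.linear s s q \<and> q \<circ> q = q \<and>
     u = (\<lambda>v. s a (p v) + s b (q v)))"

definition poly_endo ::
    "('k::field \<Rightarrow> 'v::ab_group_add \<Rightarrow> 'v) \<Rightarrow> 'k poly \<Rightarrow> ('v \<Rightarrow> 'v) \<Rightarrow> 'v \<Rightarrow> 'v" where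
  "poly_endo s f u v = (\<Sum>i\<le>degree f. s (coeff f i) ((u ^^ i) v))"

definition minimal_poly ::
    "('k::field \<Rightarrow> 'v::ab_group_add \<Rightarrow> 'v) \<Rightarrow> ('v \<Rightarrow> 'v) \<Rightarrow> 'k poly" where
  "minimal_poly s u = (THE m. lead_coeff m = 1 \<and> (\<forall>v. poly_endo s m u v = 0) \<and>
     (\<forall>f. (\<forall>v. poly_endo s f u v = 0) \<longrightarrow> m dvd f))"

text \<open>The underlying space of the endomorphism written \<open>u\<close> with index \<open>-\<Lambda>\<close>; that
  endomorphism is the restriction of \<open>u\<close> to this invariant subspace.\<close>

definition part_without ::
    "('k::field \<Rightarrow> 'v::ab_group_add \<Rightarrow> 'v) \<Rightarrow> 'k set \<Rightarrow> ('v \<Rightarrow> 'v) \<Rightarrow> 'v set" where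
  "part_without s \<Lambda> u = {v. poly_endo s (remove_roots \<Lambda> (minimal_poly s u)) u v = 0}"

text \<open>The restriction of \<open>u\<close> to the subspace \<open>W\<close> has matrix \<open>A\<close> in some (ordered) basis of \<open>W\<close>;
  the last conjunct forces \<open>W\<close> to be invariant under a linear \<open>u\<close>.\<close>

definition represented_on ::
    "('k::field \<Rightarrow> 'v::ab_group_add \<Rightarrow> 'v) \<Rightarrow> 'v set \<Rightarrow> ('v \<Rightarrow> 'v) \<Rightarrow> 'k mat \<Rightarrow> bool" where
  "represented_on s W u A \<longleftrightarrow> (\<exists>bs.
     distinct bs \<and> \<not> module.dependent s (set bs) \<and> module.span s (set bs) = W \<and>
     A \<in> carrier_mat (length bs) (length bs) \<and>
     (\<forall>j<length bs. u (bs ! j) = (\<Sum>i<length bs. s (A $$ (i, j)) (bs ! i))))"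

text \<open>The list \<open>Ps\<close> is the sequence of elementary (invariant) factors of the restriction of
  \<open>u\<close> to \<open>W\<close>. By the rational canonical form theorem there is exactly one such list
  when \<open>W\<close> is finite-dimensional and invariant under the linear map \<open>u\<close>.\<close>

definition elementary_factors ::
    "('k::field \<Rightarrow> 'v::ab_group_add \<Rightarrow> 'v) \<Rightarrow> 'v set \<Rightarrow> ('v \<Rightarrow> 'v) \<Rightarrow> 'k poly list \<Rightarrow> bool" where
  "elementary_factors s W u Ps \<longleftrightarrow>
     (\<forall>P\<in>set Ps. lead_coeff P = 1 \<and> degree P > 0) \<and>
     (\<forall>i. Suc i < length Ps \<longrightarrow> Ps ! i dvd Ps ! Suc i) \<and>
     represented_on s W u (diag_block_mat (map companion_mat Ps))"

end

theory Submission
  imports Defs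
begin

text \<open>
  In characteristic 2 one has \<open>-\<alpha> = \<alpha>\<close>, so \<open>u\<close> is a composite iff \<open>u = \<alpha> p + \<alpha> q\<close> with idempotents
  \<open>p\<close> and \<open>q\<close>. Solving for \<open>q\<close> and squaring turns this into a condition on \<open>p\<close> alone: \<open>p\<close> is an
  idempotent with \<open>u p + p u = g(u)\<close>, where \<open>g = \<alpha>\<inverse> X (X - \<alpha>)\<close> (\<open>composite_iff\<close>). As \<open>g(u)\<close> commutes
  with \<open>u\<close>, the commutator with \<open>p\<close> acts on polynomials in \<open>u\<close> like the derivation \<open>g d/dX\<close>:
  \<open>f(u) p + p f(u) = (f' g)(u)\<close> (\<open>act_commutator\<close>). Moreover a polynomial over a field of
  characteristic 2 is even iff its derivative vanishes.

  Necessity. Let \<open>e\<close> generate a cyclic summand \<open>Z\<close> of the part \<open>W\<close> of \<open>u\<close> without the eigenvalues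
  \<open>0\<close> and \<open>\<alpha>\<close>, with annihilator \<open>P\<close>. The commutator formula gives \<open>P(u) p e = (P' g)(u) e\<close>. Multiplying
  by the factor \<open>H\<close> of the minimal polynomial that carries the roots \<open>0\<close> and \<open>\<alpha>\<close> moves \<open>p e\<close> into \<open>W\<close>;
  there \<open>P(u)\<close> kills the \<open>Z\<close>-component, and \<open>(H P' g)(u) e\<close> lies in \<open>Z\<close>, so it is zero. Hence \<open>P\<close>
  divides \<open>H P' g\<close>, and as \<open>P\<close> is coprime to \<open>H\<close> and \<open>g\<close>, it divides \<open>P'\<close>, which forces \<open>P' = 0\<close>
  (\<open>summand_pderiv_eq_0\<close>).

  Sufficiency. On \<open>K[X]/(P)\<close> with \<open>u\<close> the multiplication by \<open>X\<close>, the map \<open>f \<mapsto> f + g f'\<close> has the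
  properties required of \<open>p\<close>; it is well defined iff \<open>P\<close> divides \<open>g P'\<close>
  (\<open>admits_idempotent_cyclic\<close>). This divisibility holds if \<open>P\<close> is even, and also if
  \<open>P\<close> is a product of factors \<open>X\<close> and \<open>X - \<alpha>\<close>. By Bezout the space is the direct sum of \<open>W\<close> and of \<open>Ker H(u)\<close>;
  each of the two is a direct sum of cyclic subspaces, and the maps on the summands are glued.

  Sufficiency rests on the existence of the rational canonical form
  (\<open>cyclic_decomposition_exists\<close>), and both halves on the equivalence between block-diagonal companion
  matrices and decompositions into cyclic subspaces (\<open>elementary_factors_iff\<close>).
\<close>

section \<open>Polynomials over a field\<close>

lemma degree_mod_less_pos:
  fixes f g :: "'k::field poly"
  assumes "degree g > 0"
  shows "degree (f mod g) < degree g"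
proof (cases "f mod g = 0")
  case False
  moreover have "g \<noteq> 0" using assms by auto
  ultimately show ?thesis using degree_mod_less' by blast
qed (use assms in simp)

text \<open>The common source of annihilators, minimal polynomials and Bezout identities below. The generator is a
  nonzero element of least degree, made monic.\<close>

lemma poly_ideal_principal:
  fixes I :: "'k::field poly set"
  assumes "p \<in> I" "p \<noteq> 0"
    and add: "\<And>f g. f \<in> I \<Longrightarrow> g \<in> I \<Longrightarrow> f + g \<in> I"
    and mult: "\<And>f g. f \<in> I \<Longrightarrow> g * f \<in> I"
  obtains m where "lead_coeff m = 1" "\<And>f. f \<in> I \<longleftrightarrow> m dvd f"
proof -
  define Q where "Q = (\<lambda>f. f \<in> I \<and> f \<noteq> 0)"
  have "Q p" using assms by (simp add: Q_def)
  then obtain m0 where m0: "Q m0" "\<And>f. Q f \<Longrightarrow> degree m0 \<le> degree f"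
    using ex_has_least_nat[of Q p degree] by blast
  define m where "m = Polynomial.smult (inverse (lead_coeff m0)) m0"
  have nz: "m0 \<noteq> 0" and m0I: "m0 \<in> I" using m0(1) by (auto simp: Q_def)
  have mI: "m \<in> I"
    unfolding m_def using mult[OF m0I, of "[:inverse (lead_coeff m0):]"] by simp
  have deg: "degree m = degree m0" and mnz: "m \<noteq> 0" using nz by (auto simp: m_def)
  show ?thesis
  proof (rule that[of m])
    show "lead_coeff m = 1" using nz by (simp add: m_def)
    fix f
    show "f \<in> I \<longleftrightarrow> m dvd f"
    proof
      assume f: "f \<in> I"
      have "f mod m = f + (- (f div m)) * m"
        by (metis add_diff_cancel_left' diff_conv_add_uminus div_mult_mod_eq mult_minus_left)
      then have rI: "f mod m \<in> I" using add[OF f mult[OF mI]] by metis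
      have "f mod m = 0"
      proof (rule ccontr)
        assume *: "f mod m \<noteq> 0"
        then have "degree (f mod m) < degree m" using degree_mod_less' mnz by blast
        moreover have "degree m0 \<le> degree (f mod m)" using m0(2) rI * by (simp add: Q_def)
        ultimately show False using deg by simp
      qed
      then show "m dvd f" by (simp add: dvd_eq_mod_eq_0)
    next
      assume "m dvd f"
      then show "f \<in> I" using mult[OF mI] by (auto simp: mult.commute)
    qed
  qed
qed

lemma prime_elem_poly_dvd_exists:
  fixes f :: "'k::field poly"
  assumes "degree f > 0"
  obtains \<pi> where "prime_elem \<pi>" "\<pi> dvd f"
proof -
  define Q where "Q = (\<lambda>g. g dvd f \<and> degree g > 0)"
  have "Q f" using assms by (simp add: Q_def)
  then obtain \<pi> where \<pi>: "Q \<pi>" "\<And>g. Q g \<Longrightarrow> degree \<pi> \<le> degree g"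
    using ex_has_least_nat[of Q f degree] by blast
  have nz: "\<pi> \<noteq> 0" using \<pi>(1) by (auto simp: Q_def)
  have "irreducible \<pi>"
  proof (rule irreducibleI)
    show "\<pi> \<noteq> 0" by fact
    show "\<not> is_unit \<pi>" using \<pi>(1) using nz by (auto simp: Q_def is_unit_iff_degree)
    fix a b assume ab: "\<pi> = a * b"
    then have "a \<noteq> 0" "b \<noteq> 0" using nz by auto
    then have d: "degree \<pi> = degree a + degree b" using ab by (simp add: degree_mult_eq)
    have dv: "a dvd f" "b dvd f" using \<pi>(1) ab by (auto simp: Q_def dvd_def)
    show "is_unit a \<or> is_unit b"
    proof (cases "degree a = 0")
      case True then show ?thesis using \<open>a \<noteq> 0\<close> by (simp add: is_unit_iff_degree)
    next
      case False
      then have "degree \<pi> \<le> degree a" using \<pi>(2) dv by (simp add: Q_def)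
      then show ?thesis using d \<open>b \<noteq> 0\<close> by (simp add: is_unit_iff_degree)
    qed
  qed
  then have "prime_elem \<pi>" by (rule field_poly_irreducible_imp_prime)
  with \<pi>(1) show ?thesis using that by (auto simp: Q_def)
qed

lemma prime_power_exact:
  fixes f :: "'k::field poly"
  assumes "prime_elem \<pi>" "f \<noteq> 0"
  obtains n f' where "f = \<pi> ^ n * f'" "\<not> \<pi> dvd f'"
proof -
  have "\<pi> \<noteq> 0" "degree \<pi> > 0" using assms(1) by (auto simp: prime_elem_def is_unit_iff_degree)
  have bound: "n \<le> degree f" if "\<pi> ^ n dvd f" for n
  proof -
    have "n \<le> degree (\<pi> ^ n)" using \<open>\<pi> \<noteq> 0\<close> \<open>degree \<pi> > 0\<close> by (simp add: degree_power_eq)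
    also have "\<dots> \<le> degree f" using that assms(2) by (rule dvd_imp_degree_le)
    finally show ?thesis .
  qed
  define n where "n = (GREATEST n. \<pi> ^ n dvd f)"
  have n: "\<pi> ^ n dvd f"
    unfolding n_def by (rule GreatestI_nat[of "\<lambda>n. \<pi> ^ n dvd f" 0 "degree f"]) (simp_all add: bound)
  have n_max: "k \<le> n" if "\<pi> ^ k dvd f" for k
    unfolding n_def by (rule Greatest_le_nat[of "\<lambda>n. \<pi> ^ n dvd f" k "degree f"]) (simp_all add: bound that)
  obtain f' where f': "f = \<pi> ^ n * f'" using n by (rule dvdE)
  have "\<not> \<pi> dvd f'"
  proof
    assume "\<pi> dvd f'"
    then have "\<pi> ^ Suc n dvd f"
      unfolding f' power_Suc2 by (rule mult_dvd_mono[OF dvd_refl])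
    then have "Suc n \<le> n" by (rule n_max)
    then show False by simp
  qed
  with f' show ?thesis by (rule that)
qed

lemma prime_power_dvd_cancel:
  fixes a b :: "'k::field poly"
  assumes "prime_elem \<pi>" "\<not> \<pi> dvd a" "\<pi> ^ n dvd a * b"
  shows "\<pi> ^ n dvd b"
  using assms(3)
proof (induction n arbitrary: b)
  case (Suc n)
  have "\<pi> dvd a * b" using Suc.prems by (meson dvd_power dvd_trans zero_less_Suc)
  then obtain c where c: "b = \<pi> * c" using assms prime_elem_dvd_multD by blast
  have "\<pi> \<noteq> 0" using assms(1) by (simp add: prime_elem_def)
  then have "\<pi> ^ n dvd a * c" using Suc.prems c by (simp add: mult.left_commute)
  then have "\<pi> ^ n dvd c" by (rule Suc.IH)
  then show ?case using c by (simp add: mult_dvd_mono)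
qed simp

text \<open>Used in the contrapositive: if \<open>g\<close> does not divide \<open>f\<close>, then some prime power separates them. The
  proof splits the exact power of one prime off \<open>g\<close> and proceeds by induction on the degree.\<close>

lemma dvd_if_prime_powers_dvd:
  fixes f g :: "'k::field poly"
  assumes "g \<noteq> 0" "\<And>\<pi> k. prime_elem \<pi> \<Longrightarrow> \<pi> ^ k dvd g \<Longrightarrow> \<pi> ^ k dvd f"
  shows "g dvd f"
  using assms
proof (induction "degree g" arbitrary: g rule: less_induct)
  case less
  show ?case
  proof (cases "degree g = 0")
    case True then show ?thesis using less.prems(1) by (simp add: is_unit_iff_degree unit_imp_dvd)
  next
    case False
    then obtain \<pi> where \<pi>: "prime_elem \<pi>" "\<pi> dvd g" using prime_elem_poly_dvd_exists by blast
    obtain n g' where g: "g = \<pi> ^ n * g'" "\<not> \<pi> dvd g'"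
      using prime_power_exact[OF \<pi>(1) less.prems(1)] by metis
    have "n \<noteq> 0" using g \<pi>(2) by (metis mult_1 power_0)
    have "degree \<pi> > 0" "\<pi> \<noteq> 0"
      using \<pi>(1) by (auto simp: prime_elem_def is_unit_iff_degree)
    have "g' \<noteq> 0" using g by auto
    have "degree g' < degree g"
      using \<open>n \<noteq> 0\<close> \<open>degree \<pi> > 0\<close> \<open>\<pi> \<noteq> 0\<close> \<open>g' \<noteq> 0\<close>
      by (simp add: g(1) degree_mult_eq degree_power_eq)
    then have "g' dvd f"
      using less.hyps[of g'] \<open>g' \<noteq> 0\<close> less.prems(2) g(1) by (metis dvd_mult)
    then obtain h where h: "f = g' * h" by auto
    have "\<pi> ^ n dvd f" using less.prems(2)[OF \<pi>(1)] g(1) by simp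
    then have "\<pi> ^ n dvd h" using prime_power_dvd_cancel \<pi>(1) g(2) h by blast
    then show ?thesis using g(1) h by (simp add: mult.commute mult_dvd_mono)
  qed
qed

text \<open>A case of Euclid's lemma: the cofactor of \<open>P\<close> must absorb the
  linear factor because \<open>P\<close> does not vanish at \<open>c\<close>.\<close>

lemma dvd_linear_cancel:
  fixes P R :: "'k::field poly"
  assumes "P dvd [:- c, 1:] * R" "poly P c \<noteq> 0"
  shows "P dvd R"
proof -
  obtain T where T: "[:- c, 1:] * R = P * T" using assms(1) by auto
  have "poly ([:- c, 1:] * R) c = 0" by simp
  then have "poly P c * poly T c = 0" using T by (metis poly_mult)
  then have "poly T c = 0" using assms(2) by simp
  then obtain T' where "T = [:- c, 1:] * T'" using poly_eq_0_iff_dvd by blast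
  then have "[:- c, 1:] * R = [:- c, 1:] * (P * T')" using T by (simp add: mult.left_commute)
  moreover have "[:- c, 1:] \<noteq> 0" by simp
  ultimately have "R = P * T'" using mult_left_cancel by blast
  then show ?thesis by simp
qed

lemma dvd_linear_factors_cancel:
  fixes P R :: "'k::field poly"
  assumes "P dvd (\<Prod>c\<in>#M. [:- c, 1:]) * R" "\<And>c. c \<in># M \<Longrightarrow> poly P c \<noteq> 0"
  shows "P dvd R"
  using assms
proof (induction M)
  case (add x M)
  have "P dvd [:- x, 1:] * ((\<Prod>c\<in>#M. [:- c, 1:]) * R)"
    using add.prems(1) by (simp only: image_mset_add_mset prod_mset.add_mset mult.assoc)
  then have "P dvd (\<Prod>c\<in>#M. [:- c, 1:]) * R"
    by (rule dvd_linear_cancel) (rule add.prems(2), simp)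
  then show ?case by (rule add.IH) (rule add.prems(2), simp)
qed simp

lemma monic_dvd_antisym:
  fixes f g :: "'k::field poly"
  assumes "lead_coeff f = 1" "lead_coeff g = 1" "f dvd g" "g dvd f"
  shows "f = g"
proof -
  obtain h where h: "g = f * h" using assms(3) by auto
  have "g \<noteq> 0" using assms(2) by auto
  then have "f \<noteq> 0" "h \<noteq> 0" using h by auto
  have "degree g \<le> degree f" using assms(4) \<open>f \<noteq> 0\<close> by (rule dvd_imp_degree_le)
  then have "degree h = 0" using h \<open>f \<noteq> 0\<close> \<open>h \<noteq> 0\<close> by (simp add: degree_mult_eq)
  then obtain c where c: "h = [:c:]" by (rule degree_eq_zeroE)
  have "lead_coeff h = 1" using assms h by (simp add: lead_coeff_mult)
  then have "h = 1" using c by (simp add: one_pCons)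
  with h show ?thesis by simp
qed

lemma linear_factors_split:
  fixes f :: "'k::field poly"
  assumes "lead_coeff f = 1"
  shows "\<exists>M Q. set_mset M \<subseteq> \<Lambda> \<and> f = (\<Prod>c\<in>#M. [:- c, 1:]) * Q \<and> lead_coeff Q = 1
    \<and> (\<forall>c\<in>\<Lambda>. poly Q c \<noteq> 0)"
  using assms
proof (induction "degree f" arbitrary: f rule: less_induct)
  case less
  show ?case
  proof (cases "\<forall>c\<in>\<Lambda>. poly f c \<noteq> 0")
    case True then show ?thesis using less.prems by (intro exI[of _ "{#}"] exI[of _ f]) auto
  next
    case False
    then obtain c g where c: "c \<in> \<Lambda>" and g: "f = [:- c, 1:] * g"
      using poly_eq_0_iff_dvd by blast
    have "g \<noteq> 0" using less.prems g by auto
    have "lead_coeff g = 1" using less.prems unfolding g by (simp add: lead_coeff_mult del: mult_pCons_left)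
    moreover have "degree g < degree f" unfolding g using \<open>g \<noteq> 0\<close> by (simp add: degree_mult_eq del: mult_pCons_left)
    ultimately obtain M Q where "set_mset M \<subseteq> \<Lambda>" "g = (\<Prod>c\<in>#M. [:- c, 1:]) * Q"
      "lead_coeff Q = 1" "\<forall>c\<in>\<Lambda>. poly Q c \<noteq> 0"
      using less.hyps[of g] by blast
    then show ?thesis using c g
      by (intro exI[of _ "add_mset c M"] exI[of _ Q]) (simp add: mult.assoc del: mult_pCons_left)
  qed
qed

text \<open>Existence follows by dividing out roots; two admissible \<open>Q\<close> divide each other because linear
  factors with roots in \<open>\<Lambda>\<close> can be cancelled against a polynomial without such roots. This gives the
  description operator in \<open>remove_roots\<close> its meaning.\<close>

lemma remove_roots_decomposition:
  fixes f :: "'k::field poly"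
  assumes "lead_coeff f = 1"
  obtains M where "set_mset M \<subseteq> \<Lambda>" "f = (\<Prod>c\<in>#M. [:- c, 1:]) * remove_roots \<Lambda> f"
    "lead_coeff (remove_roots \<Lambda> f) = 1" "\<And>c. c \<in> \<Lambda> \<Longrightarrow> poly (remove_roots \<Lambda> f) c \<noteq> 0"
proof -
  let ?S = "\<lambda>Q. lead_coeff Q = 1 \<and> (\<forall>c\<in>\<Lambda>. poly Q c \<noteq> 0) \<and>
     (\<exists>M. set_mset M \<subseteq> \<Lambda> \<and> f = (\<Prod>c\<in>#M. [:- c, 1:]) * Q)"
  have dvd: "Q dvd Q'" if Q: "?S Q" and Q': "?S Q'" for Q Q'
  proof -
    obtain M' where "set_mset M' \<subseteq> \<Lambda>" "f = (\<Prod>c\<in>#M'. [:- c, 1:]) * Q'" using Q' by blast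
    moreover have "Q dvd f" using Q by (metis dvd_triv_right)
    moreover have "poly Q c \<noteq> 0" if "c \<in># M'" for c
      using that Q \<open>set_mset M' \<subseteq> \<Lambda>\<close> by blast
    ultimately show ?thesis using dvd_linear_factors_cancel[of Q M' Q'] by metis
  qed
  have "\<exists>!Q. ?S Q"
  proof -
    obtain Q where "?S Q" using linear_factors_split[OF assms, of \<Lambda>] by blast
    moreover have "Q' = Q" if "?S Q'" for Q'
      using monic_dvd_antisym[of Q' Q] dvd[OF that \<open>?S Q\<close>] dvd[OF \<open>?S Q\<close> that] that \<open>?S Q\<close> by metis
    ultimately show ?thesis by blast
  qed
  then have "?S (remove_roots \<Lambda> f)"
    unfolding remove_roots_def by (rule theI')
  then show ?thesis using that by blast
qed

text \<open>Such a \<open>P\<close> splits into linear factors. At a root of multiplicity \<open>k\<close>, the derivative has a root of multiplicity at least \<open>k - 1\<close>, and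
  \<open>g\<close> supplies the missing factor.\<close>

lemma dvd_multiple_pderiv_if_linear_factors:
  fixes P g :: "'k::field poly"
  assumes "P dvd (\<Prod>c\<in>#M. [:- c, 1:])" "\<And>c. c \<in># M \<Longrightarrow> poly g c = 0"
  shows "P dvd g * pderiv P"
  using assms(1)
proof (induction "degree P" arbitrary: P rule: less_induct)
  case less
  let ?H = "\<Prod>c\<in>#M. [:- c, 1:]"
  have "?H \<noteq> 0" by (auto simp: prod_mset_zero_iff)
  then have "P \<noteq> 0" using less.prems by auto
  show ?case
  proof (cases "\<exists>c. c \<in># M \<and> poly P c = 0")
    case False
    then have "P dvd 1" using less.prems by (intro dvd_linear_factors_cancel[of P M 1]) auto
    then show ?thesis by (rule unit_imp_dvd)
  next
    case True
    then obtain c R where c: "c \<in># M" and R: "P = [:- c, 1:] * R" using poly_eq_0_iff_dvd by blast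
    have "R \<noteq> 0" using \<open>P \<noteq> 0\<close> R by auto
    have "degree R < degree P" unfolding R using \<open>R \<noteq> 0\<close> by (simp add: degree_mult_eq del: mult_pCons_left)
    moreover have "R dvd ?H" using less.prems R dvd_mult_right by blast
    ultimately have IH: "R dvd g * pderiv R" by (rule less.hyps)
    have "[:- c, 1:] dvd g" using assms(2)[OF c] by (simp add: poly_eq_0_iff_dvd)
    then have "P dvd g * R" unfolding R by (rule mult_dvd_mono) simp
    moreover have "P dvd [:- c, 1:] * (g * pderiv R)" unfolding R using IH by (rule mult_dvd_mono[OF dvd_refl])
    moreover have "g * pderiv P = [:- c, 1:] * (g * pderiv R) + g * R"
      unfolding R pderiv_mult by (simp add: pderiv_pCons algebra_simps del: mult_pCons_left)
    ultimately show ?thesis by simp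
  qed
qed

text \<open>A generator of the ideal spanned by \<open>Q\<close> and the product divides both, hence it has no root
  in \<open>M\<close> and yet divides a product of linear factors with roots in \<open>M\<close>: it is a unit.\<close>

lemma linear_factors_bezout:
  fixes Q :: "'k::field poly"
  assumes "Q \<noteq> 0" "\<And>c. c \<in># M \<Longrightarrow> poly Q c \<noteq> 0"
  obtains a b where "a * Q + b * (\<Prod>c\<in>#M. [:- c, 1:]) = 1"
proof -
  let ?H = "\<Prod>c\<in>#M. [:- c, 1:]"
  define I where "I = {a * Q + b * ?H | a b. True}"
  have Q: "Q \<in> I" unfolding I_def by (rule CollectI, rule exI[of _ 1], rule exI[of _ 0]) simp
  have H: "?H \<in> I" unfolding I_def by (rule CollectI, rule exI[of _ 0], rule exI[of _ 1]) simp
  have add: "f + g \<in> I" if fg: "f \<in> I" "g \<in> I" for f g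
  proof -
    obtain a b a' b' where "f = a * Q + b * ?H" "g = a' * Q + b' * ?H" using fg by (auto simp: I_def)
    then have "f + g = (a + a') * Q + (b + b') * ?H" by (simp add: algebra_simps)
    then show ?thesis unfolding I_def by blast
  qed
  have mult: "g * f \<in> I" if f: "f \<in> I" for f g
  proof -
    obtain a b where "f = a * Q + b * ?H" using f by (auto simp: I_def)
    then have "g * f = (g * a) * Q + (g * b) * ?H" by (simp add: algebra_simps)
    then show ?thesis unfolding I_def by blast
  qed
  obtain m where m: "lead_coeff m = 1" "\<And>f. f \<in> I \<longleftrightarrow> m dvd f"
    using poly_ideal_principal[OF Q assms(1) add mult] by metis
  obtain k where k: "Q = m * k" using m(2) Q by auto
  have "m dvd 1"
    using m(2) H assms(2) k by (intro dvd_linear_factors_cancel[of m M 1]) auto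
  then have "1 \<in> I" using m(2) by blast
  then obtain a b where "1 = a * Q + b * ?H" unfolding I_def by blast
  from that[OF this[symmetric]] show ?thesis .
qed

section \<open>Characteristic two\<close>

lemma char_two_poly_add_self:
  fixes f :: "'k::field poly"
  assumes char: "(2::'k) = 0"
  shows "f + f = 0"
proof (rule poly_eqI)
  fix n
  have "coeff (f + f) n = 2 * coeff f n" by (simp only: coeff_add mult_2)
  then show "coeff (f + f) n = coeff 0 n" using char by simp
qed

text \<open>In characteristic 2 the derivative of \<open>A(X\<^sup>2) + X B(X\<^sup>2)\<close> is \<open>B(X\<^sup>2)\<close>. For the converse, two coefficients are
  split off at a time: \<open>P = a + b X + X\<^sup>2 R\<close> has the derivative \<open>b + X\<^sup>2 R'\<close>.\<close>

lemma even_poly_iff_pderiv_eq_0: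
  fixes P :: "'k::field poly"
  assumes char: "(2::'k) = 0"
  shows "even_poly P \<longleftrightarrow> pderiv P = 0"
proof
  assume "even_poly P"
  then obtain S where S: "P = pcompose S (monom 1 2)" by (auto simp: even_poly_def)
  have "pderiv (monom (1::'k) 2) = 0" by (simp add: pderiv_monom char)
  then show "pderiv P = 0" by (simp add: S pderiv_pcompose)
next
  have "(\<exists>S. P = pcompose S (monom 1 2))" if "pderiv P = 0"
    using that
  proof (induction "degree P" arbitrary: P rule: less_induct)
    case less
    obtain a b R where P: "P = pCons a (pCons b R)" by (metis pCons_cases)
    have eq: "pderiv P = [:b:] + monom 1 2 * pderiv R"
    proof -
      have "pderiv P = pCons b R + pCons 0 (R + pCons 0 (pderiv R))"
        by (simp add: P pderiv_pCons)
      also have "\<dots> = [:b:] + pCons 0 (R + R) + pCons 0 (pCons 0 (pderiv R))" by simp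
      also have "R + R = 0" by (rule char_two_poly_add_self[OF char])
      also have "pCons 0 (pCons 0 (pderiv R)) = monom 1 2 * pderiv R"
        by (simp add: monom_altdef power2_eq_square)
      finally show ?thesis by simp
    qed
    have "b = coeff (pderiv P) 0" unfolding eq by (simp add: coeff_monom_mult)
    then have b: "b = 0" using less.prems by simp
    then have R: "pderiv R = 0" using eq less.prems by simp
    show ?case
    proof (cases "R = 0")
      case True
      then show ?thesis using b P by (intro exI[of _ "[:a:]"]) (simp add: pcompose_const)
    next
      case False
      then have "degree R < degree P" by (simp add: P)
      then obtain S where "R = pcompose S (monom 1 2)" using less.hyps R by blast
      then show ?thesis using b P
        by (intro exI[of _ "pCons a S"]) (simp add: pcompose_pCons monom_altdef power2_eq_square)
    qed
  qed
  then show "pderiv P = 0 \<Longrightarrow> even_poly P" by (simp add: even_poly_def)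
qed

lemma char_two_pderiv_pderiv:
  fixes f :: "'k::field poly"
  assumes char: "(2::'k) = 0"
  shows "pderiv (pderiv f) = 0"
proof (induction f)
  case (pCons a f)
  have "pderiv (pderiv (pCons a f)) = (pderiv f + pderiv f) + pCons 0 (pderiv (pderiv f))"
    by (simp add: pderiv_pCons pderiv_add add.assoc)
  then show ?case using pCons.IH char_two_poly_add_self[OF char] by simp
qed simp

text \<open>In positive characteristic the degree of the derivative may drop by more than one, but a
  nonzero derivative always has a smaller degree than \<open>P\<close>.\<close>

lemma pderiv_eq_0_if_dvd:
  fixes P :: "'k::field poly"
  assumes "P dvd pderiv P"
  shows "pderiv P = 0"
proof (rule ccontr)
  assume nz: "pderiv P \<noteq> 0"
  have "coeff P (degree (pderiv P) + 1) \<noteq> 0"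
  proof
    assume "coeff P (degree (pderiv P) + 1) = 0"
    then have "coeff (pderiv P) (degree (pderiv P)) = 0" by (simp add: coeff_pderiv)
    then show False using nz by simp
  qed
  then have "degree (pderiv P) + 1 \<le> degree P" by (rule le_degree)
  moreover have "degree P \<le> degree (pderiv P)" using assms nz by (rule dvd_imp_degree_le)
  ultimately show False by simp
qed

section \<open>The action of polynomials on the space\<close>

locale endomorphism = finite_dimensional_vector_space scale Basis
  for scale :: "'k::field \<Rightarrow> 'v::ab_group_add \<Rightarrow> 'v" (infixr \<open>*s\<close> 75) and Basis :: "'v set" +
  fixes u :: "'v \<Rightarrow> 'v"
  assumes linear_u: "Vector_Spaces.linear scale scale u"
begin

abbreviation act :: "'k poly \<Rightarrow> 'v \<Rightarrow> 'v" where
  "act f v \<equiv> poly_endo scale f u v"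

lemma u_add: "u (v + w) = u v + u w"
  using linear_u by (simp add: Vector_Spaces.linear_iff)

lemma u_scale: "u (c *s v) = c *s u v"
  using linear_u by (simp add: Vector_Spaces.linear_iff)

lemma u_zero: "u 0 = 0"
  using u_scale[of 0 0] by simp

lemma u_sum: "u (sum h A) = (\<Sum>i\<in>A. u (h i))"
  by (induction A rule: infinite_finite_induct) (simp_all add: u_zero u_add)

lemma act_eq_sum:
  assumes "degree f \<le> n"
  shows "act f v = (\<Sum>i\<le>n. coeff f i *s (u ^^ i) v)"
  unfolding poly_endo_def
  by (rule sum.mono_neutral_left) (use assms in \<open>auto simp: coeff_eq_0\<close>)

lemma act_zero [simp]: "act 0 v = 0"
  by (simp add: poly_endo_def)

lemma act_pCons [simp]: "act (pCons a f) v = a *s v + u (act f v)"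
proof -
  have "act (pCons a f) v = (\<Sum>i\<le>Suc (degree f). coeff (pCons a f) i *s (u ^^ i) v)"
    by (rule act_eq_sum) (rule degree_pCons_le)
  also have "\<dots> = a *s v + (\<Sum>i\<le>degree f. u (coeff f i *s (u ^^ i) v))"
    by (simp add: sum.atMost_Suc_shift u_scale del: sum.atMost_Suc)
  finally show ?thesis by (simp add: u_sum poly_endo_def)
qed

lemma act_one [simp]: "act 1 v = v"
  by (simp add: one_pCons u_zero)

lemma act_add: "act (f + g) v = act f v + act g v"
proof -
  let ?n = "max (degree f) (degree g)"
  have "act (f + g) v = (\<Sum>i\<le>?n. coeff (f + g) i *s (u ^^ i) v)"
    by (rule act_eq_sum) (rule degree_add_le_max)
  also have "\<dots> = (\<Sum>i\<le>?n. coeff f i *s (u ^^ i) v) + (\<Sum>i\<le>?n. coeff g i *s (u ^^ i) v)"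
    by (simp add: scale_left_distrib sum.distrib)
  finally show ?thesis by (simp add: act_eq_sum[of f ?n] act_eq_sum[of g ?n])
qed

lemma act_smult: "act (Polynomial.smult c f) v = c *s act f v"
  by (induction f) (simp_all add: scale_right_distrib u_scale)

lemma act_minus: "act (- f) v = - act f v"
  using act_smult[of "-1" f v] by simp

lemma act_diff: "act (f - g) v = act f v - act g v"
  using act_add[of f "- g" v] by (simp add: act_minus)

lemma act_sum: "act (sum h A) v = (\<Sum>i\<in>A. act (h i) v)"
  by (induction A rule: infinite_finite_induct) (simp_all add: act_add)

lemma act_mult: "act (f * g) v = act f (act g v)"
  by (induction f) (simp_all add: act_add act_smult)

lemma act_commute: "act f (act g v) = act g (act f v)"
  by (metis act_mult mult.commute)

lemma act_u: "act f (u v) = u (act f v)"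
  by (induction f) (simp_all add: u_zero u_add u_scale)

lemma act_vector_add: "act f (v + w) = act f v + act f w"
  by (induction f) (simp_all add: u_add scale_right_distrib add_ac)

lemma act_vector_scale: "act f (c *s v) = c *s act f v"
  by (induction f) (simp_all add: u_scale scale_right_distrib scale_left_commute)

lemma act_vector_zero [simp]: "act f 0 = 0"
  using act_vector_scale[of f 0 0] by simp

lemma act_monom: "act (monom c i) v = c *s (u ^^ i) v"
  by (induction i) (simp_all add: monom_0 monom_Suc u_zero u_scale)

lemma funpow_u_add: "(u ^^ i) (v + w) = (u ^^ i) v + (u ^^ i) w"
  using act_vector_add[of "monom 1 i" v w] by (simp add: act_monom)

lemma funpow_u_scale: "(u ^^ i) (c *s v) = c *s (u ^^ i) v"
  using act_vector_scale[of "monom 1 i" c v] by (simp add: act_monom)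

lemma funpow_u_sum: "(u ^^ i) (sum h A) = (\<Sum>j\<in>A. (u ^^ i) (h j))"
  by (induction i) (simp_all add: u_sum)

definition invariant :: "'v set \<Rightarrow> bool" where
  "invariant W \<longleftrightarrow> subspace W \<and> (\<forall>v\<in>W. u v \<in> W)"

lemma invariant_act: "invariant W \<Longrightarrow> v \<in> W \<Longrightarrow> act f v \<in> W"
  by (induction f) (auto simp: invariant_def intro: subspace_add subspace_scale subspace_0)

lemma invariant_kernel: "invariant {v. act f v = 0}"
  unfolding invariant_def
  by (auto simp: act_vector_add act_vector_scale act_u u_zero intro!: subspaceI)

lemma invariant_orbit: "invariant (range (\<lambda>f. act f e))"
proof -
  have "act f e + act g e \<in> range (\<lambda>f. act f e)" for f g by (metis act_add rangeI)
  moreover have "c *s act f e \<in> range (\<lambda>f. act f e)" for c f by (metis act_smult rangeI)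
  moreover have "0 \<in> range (\<lambda>f. act f e)" by (metis act_zero rangeI)
  moreover have "u (act f e) \<in> range (\<lambda>f. act f e)" for f
    by (rule range_eqI[of _ _ "pCons 0 f"]) simp
  ultimately show ?thesis unfolding invariant_def by (auto intro!: subspaceI)
qed

section \<open>Annihilators and the minimal polynomial\<close>

definition annihilator :: "'v \<Rightarrow> 'k poly \<Rightarrow> bool" where
  "annihilator v m \<longleftrightarrow> lead_coeff m = 1 \<and> (\<forall>f. act f v = 0 \<longleftrightarrow> m dvd f)"

text \<open>Among the first \<open>dimension + 1\<close> iterates of \<open>v\<close> either two coincide or there is a nontrivial linear relation;
  the first case is separate because dependence is a property of sets, which forget repetitions.\<close>

lemma exists_annihilating_poly: "\<exists>f. f \<noteq> 0 \<and> act f v = 0"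
proof (cases "inj_on (\<lambda>i. (u ^^ i) v) {..dimension}")
  case False
  then obtain i j where "i \<noteq> j" and eq: "(u ^^ i) v = (u ^^ j) v" by (auto simp: inj_on_def)
  then have "monom (1::'k) i - monom 1 j \<noteq> 0" by (simp add: monom_eq_iff')
  moreover have "act (monom 1 i - monom 1 j) v = 0" using eq by (simp add: act_diff act_monom)
  ultimately show ?thesis by blast
next
  case True
  let ?S = "(\<lambda>i. (u ^^ i) v) ` {..dimension}"
  have "card ?S = Suc dimension" using card_image[OF True] by simp
  then have "dependent ?S"
    using independent_card_le_dim[of ?S UNIV] dim_UNIV by (auto simp: dimension_def)
  then obtain c w where c: "w \<in> ?S" "c w \<noteq> 0" "(\<Sum>x\<in>?S. c x *s x) = 0"
    using dependent_finite[of ?S] by auto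
  define f where "f = (\<Sum>i\<le>dimension. monom (c ((u ^^ i) v)) i)"
  have "act f v = (\<Sum>i\<le>dimension. c ((u ^^ i) v) *s (u ^^ i) v)"
    by (simp add: f_def act_sum act_monom)
  also have "\<dots> = 0" using c(3) by (simp add: sum.reindex[OF True])
  finally have "act f v = 0" .
  moreover obtain i where "i \<le> dimension" "c ((u ^^ i) v) \<noteq> 0" using c by auto
  then have "coeff f i \<noteq> 0" by (simp add: f_def coeff_sum)
  then have "f \<noteq> 0" by auto
  ultimately show ?thesis by blast
qed

lemma annihilator_exists: obtains m where "annihilator v m"
proof -
  obtain f where f: "f \<noteq> 0" "act f v = 0" using exists_annihilating_poly by blast
  obtain m where "lead_coeff m = 1" "\<And>f. f \<in> {f. act f v = 0} \<longleftrightarrow> m dvd f"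
    by (rule poly_ideal_principal[of f "{f. act f v = 0}"]) (use f in \<open>auto simp: act_add act_mult\<close>)
  then show ?thesis using that[of m] by (simp add: annihilator_def)
qed

lemma annihilator_nonzero: "annihilator v m \<Longrightarrow> m \<noteq> 0"
  by (auto simp: annihilator_def)

text \<open>The product of the annihilators of the basis vectors is a nonzero polynomial that kills the whole
  space, so the ideal of all such polynomials has a monic generator.\<close>

lemma minimal_poly_properties:
  shows "lead_coeff (minimal_poly scale u) = 1"
    and "(\<forall>v. act f v = 0) \<longleftrightarrow> minimal_poly scale u dvd f"
proof -
  let ?I = "{f. \<forall>v. act f v = 0}"
  define m where "m = (\<lambda>v. SOME m. annihilator v m)"
  have m: "annihilator v (m v)" for v
    unfolding m_def by (rule someI_ex) (meson annihilator_exists)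
  define p where "p = (\<Prod>b\<in>Basis. m b)"
  have "p \<noteq> 0" using annihilator_nonzero[OF m] finite_Basis by (simp add: p_def)
  have "act p b = 0" if "b \<in> Basis" for b
  proof -
    have "m b dvd p" unfolding p_def using finite_Basis that by (rule dvd_prodI)
    then show ?thesis using m[of b] by (simp add: annihilator_def)
  qed
  moreover have "subspace {v. act p v = 0}" using invariant_kernel by (simp add: invariant_def)
  ultimately have "span Basis \<subseteq> {v. act p v = 0}" by (intro span_minimal) auto
  then have "p \<in> ?I" using span_Basis by auto
  then obtain q where q: "lead_coeff q = 1" "\<And>f. f \<in> ?I \<longleftrightarrow> q dvd f"
    by (rule poly_ideal_principal) (use \<open>p \<noteq> 0\<close> in \<open>auto simp: act_add act_mult\<close>)
  have q_iff: "(\<forall>v. act f v = 0) \<longleftrightarrow> q dvd f" for f using q(2)[of f] by simp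
  have q_kills: "\<forall>v. act q v = 0" by (subst q_iff) simp
  have "minimal_poly scale u = q"
    unfolding minimal_poly_def
  proof (rule the_equality)
    show "lead_coeff q = 1 \<and> (\<forall>v. act q v = 0) \<and> (\<forall>f. (\<forall>v. act f v = 0) \<longrightarrow> q dvd f)"
      by (intro conjI q(1) q_kills) (simp add: q_iff)
    fix r
    assume r: "lead_coeff r = 1 \<and> (\<forall>v. act r v = 0) \<and> (\<forall>f. (\<forall>v. act f v = 0) \<longrightarrow> r dvd f)"
    have "q dvd r" by (subst q_iff[symmetric]) (rule r[THEN conjunct2, THEN conjunct1])
    moreover have "r dvd q" using r q_kills by simp
    ultimately show "r = q" using monic_dvd_antisym[OF conjunct1[OF r] q(1)] by simp
  qed
  then show "lead_coeff (minimal_poly scale u) = 1"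
    and "(\<forall>v. act f v = 0) \<longleftrightarrow> minimal_poly scale u dvd f"
    using q(1) q_iff by simp_all
qed

text \<open>Pick a prime power \<open>\<pi>\<^sup>k\<close> dividing \<open>g\<close> but not \<open>f = \<pi>\<^sup>n f'\<close>, so that \<open>n < k\<close>. Multiples of \<open>e\<close> and \<open>y\<close> have
  the annihilators \<open>f'\<close> and \<open>\<pi>\<^sup>k\<close>; as these are coprime, their sum has an annihilator divisible by
  \<open>f' \<pi>\<^sup>k\<close>, whose degree exceeds that of \<open>f\<close>.\<close>

lemma annihilator_increase:
  assumes e: "annihilator e f" and y: "annihilator y g" and "\<not> g dvd f"
  obtains a b h where "annihilator (act a e + act b y) h" "degree f < degree h"
proof -
  have nz: "f \<noteq> 0" "g \<noteq> 0" using e y annihilator_nonzero by blast+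
  have ef: "act h e = 0 \<longleftrightarrow> f dvd h" for h using e by (simp add: annihilator_def)
  have yg: "act h y = 0 \<longleftrightarrow> g dvd h" for h using y by (simp add: annihilator_def)
  obtain \<pi> k where \<pi>: "prime_elem \<pi>" and g: "\<pi> ^ k dvd g" and nf: "\<not> \<pi> ^ k dvd f"
    using dvd_if_prime_powers_dvd[of g f] assms nz by blast
  obtain n f' where f: "f = \<pi> ^ n * f'" and f': "\<not> \<pi> dvd f'"
    using prime_power_exact[OF \<pi> nz(1)] by blast
  obtain g' where g: "g = \<pi> ^ k * g'" using g by blast
  have "\<pi> \<noteq> 0" "degree \<pi> > 0" using \<pi> by (auto simp: prime_elem_def is_unit_iff_degree)
  have "n < k"
  proof (rule ccontr)
    assume "\<not> n < k"
    then have "\<pi> ^ k dvd f" unfolding f by (simp add: le_imp_power_dvd)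
    with nf show False by contradiction
  qed
  let ?x = "act (\<pi> ^ n) e" and ?y = "act g' y"
  have x: "act h ?x = 0 \<longleftrightarrow> f' dvd h" for h
  proof -
    have "act h ?x = 0 \<longleftrightarrow> f dvd \<pi> ^ n * h" by (metis act_mult ef mult.commute)
    then show ?thesis using \<open>\<pi> \<noteq> 0\<close> by (simp add: f)
  qed
  have y: "act h ?y = 0 \<longleftrightarrow> \<pi> ^ k dvd h" for h
  proof -
    have "act h ?y = 0 \<longleftrightarrow> g dvd h * g'" by (metis act_mult yg)
    then show ?thesis using nz(2) by (simp add: g)
  qed
  have main: "f' * \<pi> ^ k dvd h" if h: "act h (?x + ?y) = 0" for h
  proof -
    have sum: "act h ?x + act h ?y = 0" using h by (simp add: act_vector_add)
    \<comment> \<open>Applying \<open>f'\<close> removes the first summand, so \<open>\<pi>\<^sup>k\<close> divides \<open>h\<close>, and then the second summand vanishes too.\<close>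
    have "act (f' * h) ?x = 0" by (simp add: x)
    then have "act (f' * h) ?y = 0"
      using sum act_mult[of f' h ?x] act_mult[of f' h ?y] act_vector_add[of f' "act h ?x" "act h ?y"]
      by simp
    then have "\<pi> ^ k dvd f' * h" by (simp add: y)
    then have \<pi>h: "\<pi> ^ k dvd h" by (rule prime_power_dvd_cancel[OF \<pi> f'])
    then have "act h ?y = 0" by (simp only: y)
    then have "act h ?x = 0" using sum by simp
    then obtain t where t: "h = f' * t" by (auto simp: x)
    then have "\<pi> ^ k dvd t" using \<pi>h prime_power_dvd_cancel[OF \<pi> f'] by blast
    then show ?thesis unfolding t by (rule mult_dvd_mono[OF dvd_refl])
  qed
  obtain h where h: "annihilator (?x + ?y) h" using annihilator_exists by blast
  have "h \<noteq> 0" using h by (rule annihilator_nonzero)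
  have "f' * \<pi> ^ k dvd h" using main h by (simp add: annihilator_def)
  then have "degree (f' * \<pi> ^ k) \<le> degree h" using \<open>h \<noteq> 0\<close> by (rule dvd_imp_degree_le)
  moreover have "degree f < degree (f' * \<pi> ^ k)"
    using nz(1) \<open>\<pi> \<noteq> 0\<close> \<open>degree \<pi> > 0\<close> \<open>n < k\<close> unfolding f
    by (auto simp: degree_mult_eq degree_power_eq)
  ultimately show ?thesis using that[OF h] by simp
qed

text \<open>Choose \<open>e\<close> in \<open>W\<close> with an annihilator of greatest degree: by \<open>annihilator_increase\<close>, every other annihilator
  of a vector in \<open>W\<close> divides it. The annihilator of \<open>e\<close> is then the minimal polynomial of \<open>u\<close> on \<open>W\<close>.\<close>

lemma vector_with_maximal_annihilator:
  assumes W: "invariant W"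
  obtains e m where "e \<in> W" "annihilator e m" "\<And>v. v \<in> W \<Longrightarrow> act m v = 0"
proof -
  define R where "R = (\<lambda>(e, m). e \<in> W \<and> annihilator e m)"
  have bound: "degree m \<le> degree (minimal_poly scale u)" if "R (e, m)" for e m
  proof -
    have "act (minimal_poly scale u) e = 0" using minimal_poly_properties(2)[of "minimal_poly scale u"] by simp
    then have "m dvd minimal_poly scale u" using that by (auto simp: R_def annihilator_def)
    moreover have "minimal_poly scale u \<noteq> 0" using minimal_poly_properties(1) by auto
    ultimately show ?thesis by (rule dvd_imp_degree_le)
  qed
  obtain m0 where "annihilator 0 m0" by (rule annihilator_exists)
  then have "R (0, m0)" using W by (simp add: R_def invariant_def subspace_0)
  moreover have "\<forall>x. R x \<longrightarrow> degree (snd x) < Suc (degree (minimal_poly scale u))"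
    using bound by (auto simp: less_Suc_eq_le)
  ultimately have "\<exists>x. R x \<and> (\<forall>y. R y \<longrightarrow> degree (snd y) \<le> degree (snd x))"
    by (rule ex_has_greatest_nat)
  then obtain x where x: "R x" "\<forall>y. R y \<longrightarrow> degree (snd y) \<le> degree (snd x)" by blast
  obtain e m where em: "x = (e, m)" by fastforce
  have "act m v = 0" if v: "v \<in> W" for v
  proof -
    obtain g where g: "annihilator v g" by (rule annihilator_exists)
    have "g dvd m"
    proof (rule ccontr)
      assume "\<not> g dvd m"
      then obtain a b h where h: "annihilator (act a e + act b v) h" "degree m < degree h"
        using annihilator_increase[of e m v g] x(1) g by (auto simp: R_def em)
      have "act a e + act b v \<in> W"
        using invariant_act[OF W] v x(1) W by (auto simp: R_def em invariant_def intro: subspace_add)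
      then have "R (act a e + act b v, h)" using h by (simp add: R_def)
      then have "degree h \<le> degree m" using x(2)[rule_format, of "(act a e + act b v, h)"] by (simp add: em)
      then show False using h(2) by simp
    qed
    then show ?thesis using g unfolding annihilator_def by blast
  qed
  moreover have "e \<in> W" "annihilator e m" using x(1) by (simp_all add: R_def em)
  ultimately show ?thesis using that by blast
qed

section \<open>Decomposition into cyclic subspaces\<close>

definition direct_sum :: "'v set \<Rightarrow> 'v set \<Rightarrow> 'v set \<Rightarrow> bool" where
  "direct_sum W Z C \<longleftrightarrow> W = {z + c |z c. z \<in> Z \<and> c \<in> C} \<and> Z \<inter> C = {0}"

lemma direct_sum_unique:
  assumes "direct_sum W Z C" "subspace Z" "subspace C"
    and "z \<in> Z" "z' \<in> Z" "c \<in> C" "c' \<in> C" "z + c = z' + c'"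
  shows "z = z'" "c = c'"
proof -
  have "z - z' = c' - c" using assms(8) by (simp add: algebra_simps)
  moreover have "z - z' \<in> Z" "c' - c \<in> C" using assms by (simp_all add: subspace_diff)
  ultimately have "z - z' \<in> Z \<inter> C" by simp
  then have "z - z' = 0" using assms(1) unfolding direct_sum_def by blast
  then show "z = z'" by simp
  then show "c = c'" using assms(8) by simp
qed

lemma direct_sum_subset:
  assumes "direct_sum W Z C" "subspace Z" "subspace C"
  shows "Z \<subseteq> W" "C \<subseteq> W"
proof -
  have "z + 0 \<in> W" if "z \<in> Z" for z
    using that assms subspace_0 unfolding direct_sum_def by blast
  then show "Z \<subseteq> W" by auto
  have "0 + c \<in> W" if "c \<in> C" for c
    using that assms subspace_0 unfolding direct_sum_def by blast
  then show "C \<subseteq> W" by auto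
qed

lemma invariant_direct_sum:
  assumes "direct_sum W Z C" "invariant Z" "invariant C"
  shows "invariant W"
proof -
  have W: "W = {z + c |z c. z \<in> Z \<and> c \<in> C}" using assms(1) by (simp add: direct_sum_def)
  have "subspace W" unfolding W
    using assms(2,3) by (intro subspace_sums) (simp_all add: invariant_def)
  moreover have "u v \<in> W" if "v \<in> W" for v
    using that assms(2,3) unfolding W invariant_def by (force simp: u_add)
  ultimately show ?thesis by (simp add: invariant_def)
qed

definition cyclic :: "'v set \<Rightarrow> 'k poly \<Rightarrow> bool" where
  "cyclic Z P \<longleftrightarrow> degree P > 0 \<and> (\<exists>e. annihilator e P \<and> Z = range (\<lambda>f. act f e))"

lemma invariant_cyclic: "cyclic Z P \<Longrightarrow> invariant Z"
  by (auto simp: cyclic_def invariant_orbit)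

text \<open>The recursion follows that of \<open>diag_block_mat\<close>: the first block against the rest.\<close>

fun cyclic_decomposition :: "'v set \<Rightarrow> 'k poly list \<Rightarrow> bool" where
  "cyclic_decomposition W [] \<longleftrightarrow> W = {0}"
| "cyclic_decomposition W (P # Ps) \<longleftrightarrow>
    (\<exists>Z C. cyclic Z P \<and> cyclic_decomposition C Ps \<and> direct_sum W Z C)"

lemma invariant_cyclic_decomposition: "cyclic_decomposition W Ps \<Longrightarrow> invariant W"
proof (induction Ps arbitrary: W)
  case Nil then show ?case by (simp add: invariant_def u_zero)
next
  case (Cons P Ps) then show ?case using invariant_direct_sum invariant_cyclic by auto
qed

text \<open>Associativity and commutativity of direct sums: from \<open>Z \<oplus> (Z1 \<oplus> C1)\<close> to \<open>Z1 \<oplus> (Z \<oplus> C1)\<close>. It brings any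
  summand of a cyclic decomposition to the front and allows one to append a summand at the end.\<close>

lemma direct_sum_rotate:
  assumes W: "direct_sum W Z C" and C: "direct_sum C Z1 C1"
    and sub: "subspace Z" "subspace Z1" "subspace C1"
  obtains C' where "direct_sum W Z1 C'" "direct_sum C' Z C1"
proof -
  define C' where "C' = {z + c |z c. z \<in> Z \<and> c \<in> C1}"
  have C_eq: "C = {z + c |z c. z \<in> Z1 \<and> c \<in> C1}" using C by (simp add: direct_sum_def)
  have subC: "subspace C" unfolding C_eq by (rule subspace_sums[OF sub(2,3)])
  note C_incl = direct_sum_subset[OF C sub(2,3)]
  have zero: "0 \<in> Z" "0 \<in> Z1" "0 \<in> C1" using sub by (simp_all add: subspace_0)
  have "Z \<inter> C1 = {0}" using W C_incl zero by (auto simp: direct_sum_def)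
  then have "direct_sum C' Z C1" by (simp add: direct_sum_def C'_def)
  moreover have "direct_sum W Z1 C'"
    unfolding direct_sum_def
  proof
    show "W = {z + c |z c. z \<in> Z1 \<and> c \<in> C'}"
    proof -
      have "W = {z + c |z c. z \<in> Z \<and> c \<in> C}" using W by (simp add: direct_sum_def)
      also have "\<dots> = {z + (z1 + c1) |z z1 c1. z \<in> Z \<and> z1 \<in> Z1 \<and> c1 \<in> C1}"
        unfolding C_eq by blast
      also have "\<dots> = {z1 + (z + c1) |z z1 c1. z \<in> Z \<and> z1 \<in> Z1 \<and> c1 \<in> C1}"
        by (simp add: add.left_commute)
      also have "\<dots> = {z + c |z c. z \<in> Z1 \<and> c \<in> C'}" unfolding C'_def by blast
      finally show ?thesis .
    qed
    show "Z1 \<inter> C' = {0}"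
    proof
      show "Z1 \<inter> C' \<subseteq> {0}"
      proof
        fix x assume "x \<in> Z1 \<inter> C'"
        then obtain z c1 where x: "x \<in> Z1" "x = z + c1" "z \<in> Z" "c1 \<in> C1" by (auto simp: C'_def)
        then have "x - c1 \<in> C" using C_incl subspace_diff[OF subC, of x c1] by blast
        then have "z \<in> Z \<inter> C" using x by simp
        then have "z = 0" using W unfolding direct_sum_def by blast
        then show "x \<in> {0}" using x C by (auto simp: direct_sum_def)
      qed
      have "0 + 0 \<in> C'" using zero unfolding C'_def by blast
      then show "{0} \<subseteq> Z1 \<inter> C'" using zero by simp
    qed
  qed
  ultimately show ?thesis using that by blast
qed

lemma cyclic_decomposition_append:
  assumes "cyclic_decomposition C Ps" "cyclic Z P" "direct_sum W Z C"
  shows "cyclic_decomposition W (Ps @ [P])"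
  using assms
proof (induction Ps arbitrary: W C)
  case Nil
  then have "direct_sum W Z {0}" by simp
  then show ?case using Nil.prems(2) by auto
next
  case (Cons P1 Ps)
  then obtain Z1 C1 where ZC: "cyclic Z1 P1" "cyclic_decomposition C1 Ps" "direct_sum C Z1 C1" by auto
  have "subspace Z" "subspace Z1" "subspace C1"
    using invariant_cyclic[OF Cons.prems(2)] invariant_cyclic[OF ZC(1)]
      invariant_cyclic_decomposition[OF ZC(2)] by (auto simp: invariant_def)
  from direct_sum_rotate[OF Cons.prems(3) ZC(3) this]
  obtain C' where C': "direct_sum W Z1 C'" "direct_sum C' Z C1" .
  have "cyclic_decomposition C' (Ps @ [P])" by (rule Cons.IH[OF ZC(2) Cons.prems(2) C'(2)])
  then show ?case using ZC(1) C'(1) by auto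
qed

lemma cyclic_decomposition_summand:
  assumes "cyclic_decomposition W Ps" "P \<in> set Ps"
  obtains Z C where "cyclic Z P" "invariant C" "direct_sum W Z C"
  using assms
proof (induction Ps arbitrary: W thesis)
  case (Cons P1 Ps)
  then obtain Z1 C1 where ZC: "cyclic Z1 P1" "cyclic_decomposition C1 Ps" "direct_sum W Z1 C1" by auto
  have inv: "invariant Z1" "invariant C1"
    using invariant_cyclic[OF ZC(1)] invariant_cyclic_decomposition[OF ZC(2)] by auto
  show ?case
  proof (cases "P = P1")
    case True
    then show ?thesis using Cons.prems(1) ZC inv by blast
  next
    case False
    then have "P \<in> set Ps" using Cons.prems(3) by simp
    then obtain Z C where Z: "cyclic Z P" "invariant C" "direct_sum C1 Z C" using Cons.IH ZC(2) by blast
    have sub: "subspace Z1" "subspace Z" "subspace C"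
      using inv invariant_cyclic[OF Z(1)] Z(2) by (auto simp: invariant_def)
    from direct_sum_rotate[OF ZC(3) Z(3) sub]
    obtain C' where C': "direct_sum W Z C'" "direct_sum C' Z1 C" .
    have "invariant C'" using C'(2) inv(1) Z(2) by (rule invariant_direct_sum)
    then show ?thesis using Cons.prems(1) Z(1) C'(1) by blast
  qed
qed simp

lemma cyclic_decomposition_dvd:
  assumes "cyclic_decomposition W Ps" "P \<in> set Ps" "\<And>v. v \<in> W \<Longrightarrow> act f v = 0"
  shows "P dvd f"
proof -
  obtain Z C where ZC: "cyclic Z P" "invariant C" "direct_sum W Z C"
    using cyclic_decomposition_summand[OF assms(1,2)] by blast
  obtain e where e: "annihilator e P" "Z = range (\<lambda>f. act f e)" using ZC(1) by (auto simp: cyclic_def)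
  have "act 1 e \<in> Z" unfolding e(2) by (rule rangeI)
  moreover have "Z \<subseteq> W"
    using direct_sum_subset ZC invariant_cyclic[OF ZC(1)] by (simp add: invariant_def)
  ultimately have "act f e = 0" using assms(3) by auto
  then show ?thesis using e(1) by (simp add: annihilator_def)
qed

lemma powers_relation_trivial:
  assumes "annihilator e m" "(\<Sum>i<degree m. c i *s (u ^^ i) e) = 0" "i < degree m"
  shows "c i = 0"
proof -
  define f where "f = (\<Sum>i<degree m. monom (c i) i)"
  have cf: "coeff f j = (if j < degree m then c j else 0)" for j by (simp add: f_def coeff_sum)
  have "act f e = 0" using assms(2) by (simp add: f_def act_sum act_monom)
  then have "m dvd f" using assms(1) by (simp add: annihilator_def)
  moreover have "f = 0 \<or> degree f < degree m"
  proof (rule disjCI)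
    assume "\<not> degree f < degree m"
    then have "lead_coeff f = 0" by (simp add: cf)
    then show "f = 0" by simp
  qed
  ultimately have "f = 0" using dvd_imp_degree_le[of m f] by linarith
  then show ?thesis using cf[of i] assms(3) by simp
qed

lemma powers_independent:
  assumes "annihilator e m"
  shows "inj_on (\<lambda>i. (u ^^ i) e) {..<degree m}" "independent ((\<lambda>i. (u ^^ i) e) ` {..<degree m})"
proof -
  note zero = powers_relation_trivial[OF assms]
  show inj: "inj_on (\<lambda>i. (u ^^ i) e) {..<degree m}"
  proof (rule inj_onI, rule ccontr)
    fix i j assume ij: "i \<in> {..<degree m}" "j \<in> {..<degree m}" "(u ^^ i) e = (u ^^ j) e" "i \<noteq> j"
    let ?c = "\<lambda>k. if k = i then 1 else if k = j then -1 else (0::'k)"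
    have "(\<Sum>k<degree m. ?c k *s (u ^^ k) e) = (\<Sum>k\<in>{i,j}. ?c k *s (u ^^ k) e)"
      using ij by (intro sum.mono_neutral_right) auto
    also have "\<dots> = 0" using ij by simp
    finally have "?c i = 0" using ij zero[of ?c i] by blast
    then show False by simp
  qed
  show "independent ((\<lambda>i. (u ^^ i) e) ` {..<degree m})"
  proof (rule independent_if_scalars_zero)
    fix h x
    assume "(\<Sum>x\<in>(\<lambda>i. (u ^^ i) e) ` {..<degree m}. h x *s x) = 0"
      and x: "x \<in> (\<lambda>i. (u ^^ i) e) ` {..<degree m}"
    then have "(\<Sum>i<degree m. h ((u ^^ i) e) *s (u ^^ i) e) = 0"
      by (simp add: sum.reindex[OF inj])
    then show "h x = 0" using x zero[of "\<lambda>i. h ((u ^^ i) e)"] by auto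
  qed simp
qed

text \<open>The duality argument for the invariant complement of a cyclic subspace whose generator has the
  minimal polynomial of \<open>u\<close> on \<open>W\<close> as annihilator. With \<open>d = degree m\<close>, let \<open>\<phi>\<close> be a linear functional that maps
  \<open>u\<^sup>d\<^sup>-\<^sup>1 e\<close> to 1 and the lower iterates of \<open>e\<close> to 0. The complement \<open>C\<close> consists
  of the \<open>v\<close> in \<open>W\<close> such that \<open>\<phi>\<close> vanishes on all iterates of \<open>v\<close>. On the cyclic subspace, the system
  \<open>\<phi> (u\<^sup>i z) = t\<^sub>i\<close> for \<open>i < d\<close> has, with respect to the basis \<open>u\<^sup>d\<^sup>-\<^sup>1 e, \<dots>, e\<close>, a triangular matrix
  with ones on the diagonal, so it is uniquely solvable; uniqueness gives a trivial intersection and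
  solvability gives the sum.\<close>

lemma cyclic_complement:
  assumes W: "invariant W" and e: "e \<in> W" "annihilator e m" and deg: "degree m > 0"
    and m: "\<And>v. v \<in> W \<Longrightarrow> act m v = 0"
  obtains C where "invariant C" "direct_sum W (range (\<lambda>f. act f e)) C"
proof -
  let ?d = "degree m"
  let ?S = "(\<lambda>i. (u ^^ i) e) ` {..<?d}"
  let ?Z = "range (\<lambda>f. act f e)"
  note S = powers_independent[OF e(2)]
  define B where "B = extend_basis ?S"
  have B: "independent B" "?S \<subseteq> B" "span B = UNIV"
    unfolding B_def using S(2) by (simp_all add: independent_extend_basis extend_basis_superset)
  define \<phi> where "\<phi> v = representation B v ((u ^^ (?d - 1)) e)" for v
  have \<phi>_add: "\<phi> (v + w) = \<phi> v + \<phi> w" for v w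
    unfolding \<phi>_def using B by (simp add: representation_add)
  have \<phi>_scale: "\<phi> (c *s v) = c * \<phi> v" for c v
    unfolding \<phi>_def using B by (simp add: representation_scale)
  have \<phi>_zero: "\<phi> 0 = 0" using \<phi>_scale[of 0 0] by simp
  have \<phi>_power: "\<phi> ((u ^^ i) e) = (if i = ?d - 1 then 1 else 0)" if "i < ?d" for i
  proof -
    have "(u ^^ i) e \<in> B" using that B(2) by auto
    moreover have "(u ^^ i) e = (u ^^ (?d - 1)) e \<longleftrightarrow> i = ?d - 1"
      using S(1) that deg by (auto simp: inj_on_def)
    ultimately show ?thesis unfolding \<phi>_def using B(1) by (auto simp: representation_basis)
  qed
  have \<phi>_sum: "\<phi> (sum h A) = (\<Sum>i\<in>A. \<phi> (h i))" for h :: "nat \<Rightarrow> 'v" and A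
    by (induction A rule: infinite_finite_induct) (simp_all add: \<phi>_zero \<phi>_add)
  define C where "C = {v \<in> W. \<forall>i. \<phi> ((u ^^ i) v) = 0}"
  have C_alt: "v \<in> C \<longleftrightarrow> v \<in> W \<and> (\<forall>f. \<phi> (act f v) = 0)" for v
  proof -
    have "\<phi> (act f v) = 0" if "\<forall>i. \<phi> ((u ^^ i) v) = 0" for f
      unfolding poly_endo_def using that by (simp add: \<phi>_sum \<phi>_scale)
    moreover have "\<phi> ((u ^^ i) v) = 0" if "\<forall>f. \<phi> (act f v) = 0" for i
      using that[rule_format, of "monom 1 i"] by (simp add: act_monom)
    ultimately show ?thesis unfolding C_def by blast
  qed
  have subW: "subspace W" using W by (simp add: invariant_def)
  have "invariant C"
  proof -
    have "subspace C"
    proof (rule subspaceI)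
      show "0 \<in> C" using subW by (simp add: C_alt \<phi>_zero subspace_0)
      show "x + y \<in> C" if "x \<in> C" "y \<in> C" for x y
        using that subW by (simp add: C_alt \<phi>_add act_vector_add subspace_add)
      show "c *s x \<in> C" if "x \<in> C" for c x
        using that subW by (simp add: C_alt \<phi>_scale act_vector_scale subspace_scale)
    qed
    moreover have "u v \<in> C" if "v \<in> C" for v
    proof -
      have "\<phi> (act f (u v)) = 0" for f
        using that C_alt[of v] act_pCons[of 0 f v] by (metis act_u add_0 scale_zero_left)
      moreover have "u v \<in> W" using that W by (simp add: C_def invariant_def)
      ultimately show ?thesis by (simp add: C_alt)
    qed
    ultimately show ?thesis by (simp add: invariant_def)
  qed
  moreover have "direct_sum W ?Z C"
    unfolding direct_sum_def
  proof
    have ZW: "z \<in> W" if "z \<in> ?Z" for z using that W e(1) invariant_act by blast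
    have subZ: "subspace ?Z" using invariant_orbit by (simp add: invariant_def)
    show "?Z \<inter> C = {0}"
    proof
      show "{0} \<subseteq> ?Z \<inter> C" using subZ \<open>invariant C\<close> by (simp add: invariant_def subspace_0)
      show "?Z \<inter> C \<subseteq> {0}"
      proof
        fix x assume x: "x \<in> ?Z \<inter> C"
        then obtain f where f: "x = act f e" by blast
        define r where "r = f mod m"
        have mnz: "m \<noteq> 0" using e(2) by (rule annihilator_nonzero)
        have "act f e = act (f div m * m + r) e" by (simp add: r_def)
        also have "\<dots> = act r e" by (simp only: act_add act_mult m[OF e(1)]) simp
        finally have xr: "x = act r e" using f by simp
        have "r = 0"
        proof (rule ccontr)
          assume r: "r \<noteq> 0"
          then have dr: "degree r < ?d" unfolding r_def using mnz degree_mod_less' by blast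
          \<comment> \<open>This shift moves the leading term of \<open>r\<close> to the exponent \<open>d - 1\<close>, the only one seen by \<open>\<phi>\<close>.\<close>
          let ?k = "?d - 1 - degree r"
          have "\<phi> (act (monom 1 ?k) x) = 0" using x C_alt by blast
          moreover have "\<phi> (act (monom 1 ?k) x) = (\<Sum>i\<le>degree r. coeff r i * \<phi> ((u ^^ (?k + i)) e))"
            unfolding xr poly_endo_def[of scale r]
            by (simp add: act_monom funpow_u_sum funpow_u_scale \<phi>_scale \<phi>_sum funpow_add)
          moreover have "\<dots> = (\<Sum>i\<le>degree r. if i = degree r then coeff r i else 0)"
            using dr by (intro sum.cong) (auto simp: \<phi>_power)
          ultimately have "coeff r (degree r) = 0" by simp
          then show False using r by simp
        qed
        then show "x \<in> {0}" using xr by simp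
      qed
    qed
    show "W = {z + c |z c. z \<in> ?Z \<and> c \<in> C}"
    proof
      show "{z + c |z c. z \<in> ?Z \<and> c \<in> C} \<subseteq> W"
        using ZW subW by (auto simp: C_def intro: subspace_add)
      show "W \<subseteq> {z + c |z c. z \<in> ?Z \<and> c \<in> C}"
      proof
        fix v assume v: "v \<in> W"
        have "\<exists>z\<in>?Z. \<forall>i<k. \<phi> ((u ^^ i) z) = \<phi> ((u ^^ i) v)" if "k \<le> ?d" for k
          using that
        proof (induction k)
          case 0
          then show ?case using subZ subspace_0 by blast
        next
          case (Suc k)
          then obtain z where z: "z \<in> ?Z" "\<forall>i<k. \<phi> ((u ^^ i) z) = \<phi> ((u ^^ i) v)" by auto
          \<comment> \<open>Adding a multiple of \<open>w\<close> corrects the \<open>k\<close>-th value and leaves the earlier ones unchanged.\<close>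
          define w where "w = (u ^^ (?d - 1 - k)) e"
          have w: "\<phi> ((u ^^ i) w) = (if i = k then 1 else 0)" if "i \<le> k" for i
          proof -
            have "(u ^^ i) w = (u ^^ (i + (?d - 1 - k))) e" by (simp add: w_def funpow_add)
            then show ?thesis using that Suc.prems by (auto simp: \<phi>_power)
          qed
          have "w \<in> ?Z" unfolding w_def by (rule range_eqI[of _ _ "monom 1 (?d - 1 - k)"]) (simp add: act_monom)
          define c where "c = \<phi> ((u ^^ k) v) - \<phi> ((u ^^ k) z)"
          have "z + c *s w \<in> ?Z" using z(1) \<open>w \<in> ?Z\<close> subZ by (blast intro: subspace_add subspace_scale)
          moreover have "\<phi> ((u ^^ i) (z + c *s w)) = \<phi> ((u ^^ i) v)" if "i < Suc k" for i
            using that z(2) w[of i]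
            by (cases "i = k") (simp_all add: funpow_u_add funpow_u_scale \<phi>_add \<phi>_scale c_def)
          ultimately show ?case by blast
        qed
        from this[of ?d] obtain z where z: "z \<in> ?Z" "\<And>i. i < ?d \<Longrightarrow> \<phi> ((u ^^ i) z) = \<phi> ((u ^^ i) v)"
          by auto
        have "v - z \<in> W" using v ZW z(1) subW by (simp add: subspace_diff)
        moreover have "\<phi> (act f (v - z)) = 0" for f
        proof -
          define r where "r = f mod m"
          have "act f (v - z) = act (f div m * m + r) (v - z)" by (simp add: r_def)
          also have "\<dots> = act r (v - z)"
            by (simp only: act_add act_mult m[OF \<open>v - z \<in> W\<close>]) simp
          finally have "act f (v - z) = act r (v - z)" .
          moreover have "degree r < ?d" unfolding r_def using deg by (rule degree_mod_less_pos)
          then have "\<phi> (act r (v - z)) = (\<Sum>i\<le>degree r. coeff r i * \<phi> ((u ^^ i) (v - z)))"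
            unfolding poly_endo_def by (simp add: \<phi>_sum \<phi>_scale)
          also have "\<dots> = 0"
          proof (rule sum.neutral, rule ballI)
            fix i assume "i \<in> {..degree r}"
            then have "i < ?d" using \<open>degree r < ?d\<close> by simp
            have "\<phi> ((u ^^ i) (v - z)) + \<phi> ((u ^^ i) z) = \<phi> ((u ^^ i) v)"
              by (simp flip: \<phi>_add funpow_u_add)
            then show "coeff r i * \<phi> ((u ^^ i) (v - z)) = 0" using z(2)[OF \<open>i < ?d\<close>] by simp
          qed
          ultimately show ?thesis by simp
        qed
        ultimately have "v - z \<in> C" by (simp add: C_alt)
        moreover have "v = z + (v - z)" by simp
        ultimately show "v \<in> {z + c |z c. z \<in> ?Z \<and> c \<in> C}" using z(1) by blast
      qed
    qed
  qed
  ultimately show ?thesis by (rule that)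
qed

text \<open>Existence of the rational canonical form. Each step splits off a cyclic subspace with the largest possible
  annihilator \<open>m\<close>; all the factors of the complement divide \<open>m\<close> since \<open>m\<close> acts as zero there, so \<open>m\<close> is
  appended at the end of the divisibility chain.\<close>

theorem cyclic_decomposition_exists:
  assumes "invariant W"
  obtains Ps where "cyclic_decomposition W Ps"
    "\<And>i. Suc i < length Ps \<Longrightarrow> Ps ! i dvd Ps ! Suc i"
proof -
  have "\<exists>Ps. cyclic_decomposition W Ps \<and> (\<forall>i. Suc i < length Ps \<longrightarrow> Ps ! i dvd Ps ! Suc i)"
    using assms
  proof (induction "dim W" arbitrary: W rule: less_induct)
    case less
    obtain e m where e: "e \<in> W" "annihilator e m" and m: "\<And>v. v \<in> W \<Longrightarrow> act m v = 0"
      using vector_with_maximal_annihilator[OF less.prems] by blast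
    show ?case
    proof (cases "degree m = 0")
      case True
      then have "m = 1" using e(2) unfolding annihilator_def by (metis monic_dvd_antisym is_unit_iff_degree annihilator_nonzero e(2) one_dvd lead_coeff_1)
      then have "v = 0" if "v \<in> W" for v using m[OF that] by simp
      then have "W = {0}" using e(1) by blast
      then show ?thesis by (intro exI[of _ "[]"]) simp
    next
      case False
      let ?Z = "range (\<lambda>f. act f e)"
      obtain C where C: "invariant C" "direct_sum W ?Z C"
        using cyclic_complement[OF less.prems e _ m] False by auto
      have Z: "cyclic ?Z m" using False e(2) by (auto simp: cyclic_def)
      have "C \<subseteq> W" using direct_sum_subset(2)[OF C(2)] C(1) invariant_orbit by (simp add: invariant_def)
      moreover have "e \<notin> C"
      proof
        assume "e \<in> C"
        moreover have "act 1 e \<in> ?Z" by (rule rangeI)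
        ultimately have "act 1 e = 0" using C(2) by (auto simp: direct_sum_def)
        then have "m dvd 1" using e(2) unfolding annihilator_def by blast
        then show False using False annihilator_nonzero[OF e(2)] by (simp add: is_unit_iff_degree)
      qed
      ultimately have "C \<subset> W" using e(1) by blast
      then have "dim C < dim W"
        using C(1) less.prems
        by (intro dim_psubset) (simp add: invariant_def span_eq_iff[THEN iffD2])
      then obtain Ps where Ps: "cyclic_decomposition C Ps" "\<forall>i. Suc i < length Ps \<longrightarrow> Ps ! i dvd Ps ! Suc i"
        using less.hyps C(1) by blast
      have dvd: "P dvd m" if "P \<in> set Ps" for P
        using cyclic_decomposition_dvd[OF Ps(1) that] m \<open>C \<subseteq> W\<close> by blast
      have "cyclic_decomposition W (Ps @ [m])"
        by (rule cyclic_decomposition_append[OF Ps(1) Z C(2)])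
      moreover have "(Ps @ [m]) ! i dvd (Ps @ [m]) ! Suc i" if "Suc i < length (Ps @ [m])" for i
        using that Ps(2) dvd by (auto simp: nth_append less_Suc_eq)
      ultimately show ?thesis by blast
    qed
  qed
  then show ?thesis using that by blast
qed

section \<open>Block-diagonal companion matrices\<close>

text \<open>Coefficients are functions on the natural numbers, so that the columns of a matrix and the coefficients
  of a polynomial can be inserted directly.\<close>

definition comb :: "'v list \<Rightarrow> (nat \<Rightarrow> 'k) \<Rightarrow> 'v" where
  "comb bs c = (\<Sum>i<length bs. c i *s (bs ! i))"

definition list_basis :: "'v list \<Rightarrow> 'v set \<Rightarrow> bool" where
  "list_basis bs W \<longleftrightarrow> (\<forall>c. comb bs c = 0 \<longrightarrow> (\<forall>i<length bs. c i = 0)) \<and> range (comb bs) = W"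

lemma comb_cong: "(\<And>i. i < length bs \<Longrightarrow> c i = d i) \<Longrightarrow> comb bs c = comb bs d"
  by (simp add: comb_def)

lemma comb_add: "comb bs (\<lambda>i. c i + d i) = comb bs c + comb bs d"
  by (simp add: comb_def scale_left_distrib sum.distrib)

lemma comb_scale: "comb bs (\<lambda>i. a * c i) = a *s comb bs c"
  by (simp add: comb_def scale_sum_right)

lemma comb_zero: "comb bs (\<lambda>i. 0) = 0"
  by (simp add: comb_def)

lemma comb_minus: "comb bs (\<lambda>i. - c i) = - comb bs c"
  by (simp add: comb_def sum_negf)

lemma comb_unit: "k < length bs \<Longrightarrow> comb bs (\<lambda>i. if i = k then 1 else 0) = bs ! k"
  by (simp add: comb_def if_distrib[of "\<lambda>c. c *s _"] cong: if_cong)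

lemma comb_append: "comb (xs @ ys) c = comb xs c + comb ys (\<lambda>i. c (length xs + i))"
proof -
  have comb_snoc: "comb (zs @ [z]) c = comb zs c + c (length zs) *s z" for zs z c
    by (simp add: comb_def nth_append)
  show ?thesis
  proof (induction ys rule: rev_induct)
    case Nil then show ?case by (simp add: comb_def)
  next
    case (snoc y ys)
    have "comb ((xs @ ys) @ [y]) c = comb (xs @ ys) c + c (length (xs @ ys)) *s y" by (rule comb_snoc)
    then show ?case using snoc.IH by (simp add: comb_snoc add.assoc)
  qed
qed

lemma comb_join: "comb xs c + comb ys d = comb (xs @ ys) (\<lambda>i. if i < length xs then c i else d (i - length xs))"
  unfolding comb_append by (intro arg_cong2[where f = "(+)"] comb_cong) simp_all

lemma span_list: "span (set bs) = range (comb bs)"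
proof
  have "subspace (range (comb bs))"
  proof (rule subspaceI)
    show "0 \<in> range (comb bs)" by (rule range_eqI) (rule comb_zero[symmetric])
    show "x + y \<in> range (comb bs)" if "x \<in> range (comb bs)" "y \<in> range (comb bs)" for x y
      using that by (auto simp flip: comb_add)
    show "a *s x \<in> range (comb bs)" if "x \<in> range (comb bs)" for a x
      using that by (auto simp flip: comb_scale)
  qed
  moreover have "set bs \<subseteq> range (comb bs)"
  proof
    fix x assume "x \<in> set bs"
    then obtain k where "k < length bs" "bs ! k = x" by (auto simp: in_set_conv_nth)
    then show "x \<in> range (comb bs)" using comb_unit by (metis rangeI)
  qed
  ultimately show "span (set bs) \<subseteq> range (comb bs)" by (rule span_minimal[rotated])
  show "range (comb bs) \<subseteq> span (set bs)"
  proof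
    fix x assume "x \<in> range (comb bs)"
    then obtain c where x: "x = comb bs c" by blast
    show "x \<in> span (set bs)"
      unfolding x comb_def by (intro span_sum span_scale span_base) simp
  qed
qed

text \<open>Sets forget order and multiplicity, so the basis conditions of \<open>represented_on\<close> are replaced by
  conditions on the coefficient map of the list.\<close>

lemma list_basis_iff:
  "list_basis bs W \<longleftrightarrow> distinct bs \<and> independent (set bs) \<and> span (set bs) = W"
proof -
  have set: "set bs = (!) bs ` {..<length bs}" by (auto simp: set_conv_nth)
  have "(\<forall>c. comb bs c = 0 \<longrightarrow> (\<forall>i<length bs. c i = 0)) \<longleftrightarrow> distinct bs \<and> independent (set bs)"
    (is "?L \<longleftrightarrow> ?R")
  proof
    assume L: ?L
    have "distinct bs"
    proof (unfold distinct_conv_nth, intro allI impI notI)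
      fix i j assume ij: "i < length bs" "j < length bs" "i \<noteq> j" "bs ! i = bs ! j"
      \<comment> \<open>A repeated entry would give the relation \<open>bs ! i - bs ! j = 0\<close>.\<close>
      let ?c = "\<lambda>k. (if k = i then 1 else 0) + - (if k = j then 1 else (0::'k))"
      have "comb bs ?c = bs ! i + - (bs ! j)"
        unfolding comb_add comb_minus using ij by (simp add: comb_unit)
      then have "comb bs ?c = 0" using ij(4) by simp
      then have "?c i = 0" using L[rule_format, of ?c i] ij(1) by simp
      then show False using ij(3) by simp
    qed
    then have inj: "inj_on ((!) bs) {..<length bs}" by (simp add: inj_on_nth)
    have "independent (set bs)"
    proof (rule independent_if_scalars_zero)
      fix f x assume "(\<Sum>x\<in>set bs. f x *s x) = 0" and x: "x \<in> set bs"
      then have "comb bs (\<lambda>i. f (bs ! i)) = 0" by (simp add: set sum.reindex[OF inj] comb_def)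
      then show "f x = 0" using L x by (auto simp: in_set_conv_nth)
    qed simp
    with \<open>distinct bs\<close> show ?R by simp
  next
    assume R: ?R
    then have inj: "inj_on ((!) bs) {..<length bs}" by (simp add: inj_on_nth)
    show ?L
    proof (intro allI impI)
      fix c i assume c: "comb bs c = 0" and i: "i < length bs"
      define f where "f x = c (inv_into {..<length bs} ((!) bs) x)" for x
      have f: "f (bs ! j) = c j" if "j < length bs" for j
        using that inj by (simp add: f_def inv_into_f_f)
      have "(\<Sum>x\<in>set bs. f x *s x) = (\<Sum>j<length bs. f (bs ! j) *s (bs ! j))"
        by (simp add: set sum.reindex[OF inj])
      also have "\<dots> = 0" using c by (simp add: f comb_def)
      finally have "f (bs ! i) = 0"
        using independentD[of "set bs" "set bs" f "bs ! i"] R i by simp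
      then show "c i = 0" using f[OF i] by simp
    qed
  qed
  then show ?thesis by (auto simp: list_basis_def span_list)
qed

lemma represented_on_iff:
  "represented_on scale W u A \<longleftrightarrow> (\<exists>bs. list_basis bs W \<and> A \<in> carrier_mat (length bs) (length bs) \<and>
     (\<forall>j<length bs. u (bs ! j) = comb bs (\<lambda>i. A $$ (i, j))))"
  unfolding represented_on_def list_basis_iff comb_def by (simp only: conj_assoc)

lemma list_basis_append:
  "list_basis (xs @ ys) W \<longleftrightarrow> list_basis xs (range (comb xs)) \<and> list_basis ys (range (comb ys)) \<and>
     direct_sum W (range (comb xs)) (range (comb ys))"
proof -
  let ?Z = "range (comb xs)" and ?C = "range (comb ys)"
  have range: "range (comb (xs @ ys)) = {z + c |z c. z \<in> ?Z \<and> c \<in> ?C}"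
  proof
    show "range (comb (xs @ ys)) \<subseteq> {z + c |z c. z \<in> ?Z \<and> c \<in> ?C}"
      by (auto simp: comb_append)
    show "{z + c |z c. z \<in> ?Z \<and> c \<in> ?C} \<subseteq> range (comb (xs @ ys))"
      by (auto simp: comb_join)
  qed
  have zero: "0 \<in> ?Z" "0 \<in> ?C" by (metis comb_zero rangeI)+
  have indep: "(\<forall>c. comb (xs @ ys) c = 0 \<longrightarrow> (\<forall>i<length (xs @ ys). c i = 0)) \<longleftrightarrow>
    (\<forall>c. comb xs c = 0 \<longrightarrow> (\<forall>i<length xs. c i = 0)) \<and>
    (\<forall>c. comb ys c = 0 \<longrightarrow> (\<forall>i<length ys. c i = 0)) \<and> ?Z \<inter> ?C = {0}" (is "?L \<longleftrightarrow> ?R")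
  proof
    assume L: ?L
    have split: "(\<forall>i<length xs. c i = 0) \<and> (\<forall>i<length ys. d i = 0)"
      if "comb xs c + comb ys d = 0" for c d
    proof -
      let ?e = "\<lambda>i. if i < length xs then c i else d (i - length xs)"
      have e: "?e i = 0" if "i < length (xs @ ys)" for i
        using L \<open>comb xs c + comb ys d = 0\<close> that unfolding comb_join by blast
      have "c i = 0" if "i < length xs" for i using e[of i] that by simp
      moreover have "d i = 0" if "i < length ys" for i using e[of "length xs + i"] that by simp
      ultimately show ?thesis by blast
    qed
    have "?Z \<inter> ?C \<subseteq> {0}"
    proof
      fix x assume "x \<in> ?Z \<inter> ?C"
      then obtain c d where cd: "x = comb xs c" "x = comb ys d" by blast
      then have "comb xs c + comb ys (\<lambda>i. - d i) = 0" by (simp add: comb_minus)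
      then have "\<forall>i<length xs. c i = 0" using split by blast
      then have "comb xs c = comb xs (\<lambda>i. 0)" by (intro comb_cong) simp
      then show "x \<in> {0}" using cd by (simp add: comb_zero)
    qed
    moreover have "\<forall>i<length xs. c i = 0" if "comb xs c = 0" for c
      using split[of c "\<lambda>i. 0"] that by (simp add: comb_zero)
    moreover have "\<forall>i<length ys. d i = 0" if "comb ys d = 0" for d
      using split[of "\<lambda>i. 0" d] that by (simp add: comb_zero)
    ultimately show ?R using zero by blast
  next
    assume R: ?R
    show ?L
    proof (intro allI impI)
      fix c i assume c: "comb (xs @ ys) c = 0" and i: "i < length (xs @ ys)"
      let ?d = "\<lambda>i. c (length xs + i)"
      have "comb xs c = comb ys (\<lambda>i. - ?d i)"
        using c by (simp add: comb_append comb_minus add_eq_0_iff2)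
      then have "comb xs c \<in> ?Z \<inter> ?C" by (metis IntI rangeI)
      then have "comb xs c = 0" using R by blast
      moreover from this have "comb ys ?d = 0" using c by (simp add: comb_append)
      ultimately have *: "\<forall>i<length xs. c i = 0" "\<forall>i<length ys. ?d i = 0" using R by blast+
      show "c i = 0"
      proof (cases "i < length xs")
        case True then show ?thesis using * by blast
      next
        case False
        then have "i - length xs < length ys" using i by auto
        then have "c (length xs + (i - length xs)) = 0" using *(2) by blast
        then show ?thesis using False by simp
      qed
    qed
  qed
  show ?thesis
    unfolding list_basis_def direct_sum_def range indep eq_commute[of W]
    by (simp only: simp_thms conj_ac)
qed

lemma represented_on_block_diag:
  assumes A: "A \<in> carrier_mat n n" and B: "B \<in> carrier_mat m m"
  shows "represented_on scale W u (four_block_mat A (0\<^sub>m n m) (0\<^sub>m m n) B) \<longleftrightarrow>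
    (\<exists>Z C. direct_sum W Z C \<and> represented_on scale Z u A \<and> represented_on scale C u B)"
    (is "represented_on scale W u ?F \<longleftrightarrow> _")
proof -
  have F: "?F \<in> carrier_mat (n + m) (n + m)" using A B by simp
  have column: "comb (xs @ ys) (\<lambda>i. ?F $$ (i, j)) =
      (if j < n then comb xs (\<lambda>i. A $$ (i, j)) else comb ys (\<lambda>i. B $$ (i, j - n)))"
    if "length xs = n" "length ys = m" "j < n + m" for xs ys j
  proof (cases "j < n")
    case True
    have "comb xs (\<lambda>i. ?F $$ (i, j)) = comb xs (\<lambda>i. A $$ (i, j))"
      using that A B True by (intro comb_cong) simp
    moreover have "comb ys (\<lambda>i. ?F $$ (length xs + i, j)) = comb ys (\<lambda>i. 0)"
      using that A B True by (intro comb_cong) simp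
    ultimately show ?thesis using True by (simp add: comb_append comb_zero)
  next
    case False
    have "comb xs (\<lambda>i. ?F $$ (i, j)) = comb xs (\<lambda>i. 0)"
      using that A B False by (intro comb_cong) simp
    moreover have "comb ys (\<lambda>i. ?F $$ (length xs + i, j)) = comb ys (\<lambda>i. B $$ (i, j - n))"
      using that A B False by (intro comb_cong) simp
    ultimately show ?thesis using False by (simp add: comb_append comb_zero)
  qed
  show ?thesis
  proof
    assume "represented_on scale W u ?F"
    then obtain bs where bs: "list_basis bs W" "?F \<in> carrier_mat (length bs) (length bs)"
      "\<forall>j<length bs. u (bs ! j) = comb bs (\<lambda>i. ?F $$ (i, j))"
      unfolding represented_on_iff by blast
    define xs ys where "xs = take n bs" and "ys = drop n bs"
    have len: "length bs = n + m" using carrier_matD(1)[OF bs(2)] carrier_matD(1)[OF F] by (rule trans[OF sym])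
    then have xy: "bs = xs @ ys" "length xs = n" "length ys = m" by (simp_all add: xs_def ys_def)
    have x: "u (xs ! j) = comb xs (\<lambda>i. A $$ (i, j))" if "j < n" for j
      using bs(3)[rule_format, of j] column[of xs ys j] that xy by (simp add: nth_append)
    have y: "u (ys ! j) = comb ys (\<lambda>i. B $$ (i, j))" if "j < m" for j
      using bs(3)[rule_format, of "n + j"] column[of xs ys "n + j"] that xy by (simp add: nth_append)
    have "direct_sum W (range (comb xs)) (range (comb ys))"
      and "list_basis xs (range (comb xs))" "list_basis ys (range (comb ys))"
      using bs(1) by (simp_all add: xy(1) list_basis_append)
    then show "\<exists>Z C. direct_sum W Z C \<and> represented_on scale Z u A \<and> represented_on scale C u B"
      unfolding represented_on_iff using x y xy A B by blast
  next
    assume "\<exists>Z C. direct_sum W Z C \<and> represented_on scale Z u A \<and> represented_on scale C u B"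
    then obtain Z C xs ys where ds: "direct_sum W Z C"
      and xs: "list_basis xs Z" "A \<in> carrier_mat (length xs) (length xs)"
        "\<forall>j<length xs. u (xs ! j) = comb xs (\<lambda>i. A $$ (i, j))"
      and ys: "list_basis ys C" "B \<in> carrier_mat (length ys) (length ys)"
        "\<forall>j<length ys. u (ys ! j) = comb ys (\<lambda>i. B $$ (i, j))"
      unfolding represented_on_iff by blast
    have len: "length xs = n" "length ys = m" using xs(2) ys(2) A B by auto
    have "range (comb xs) = Z" "range (comb ys) = C" using xs(1) ys(1) by (simp_all add: list_basis_def)
    then have "list_basis (xs @ ys) W" using ds xs(1) ys(1) by (simp add: list_basis_append)
    moreover have "?F \<in> carrier_mat (length (xs @ ys)) (length (xs @ ys))" using F len by simp
    moreover have "u ((xs @ ys) ! j) = comb (xs @ ys) (\<lambda>i. ?F $$ (i, j))" if "j < length (xs @ ys)" for j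
      using that len column[of xs ys j] xs(3) ys(3) by (simp add: nth_append)
    ultimately show "represented_on scale W u ?F" unfolding represented_on_iff by blast
  qed
qed

lemma act_eq_comb_powers:
  assumes "degree f < d"
  shows "act f e = comb (map (\<lambda>i. (u ^^ i) e) [0..<d]) (coeff f)"
proof -
  have "act f e = (\<Sum>i\<le>d - 1. coeff f i *s (u ^^ i) e)" using assms by (intro act_eq_sum) simp
  also have "{..d - 1} = {..<d}" using assms by auto
  finally show ?thesis by (simp add: comb_def)
qed

lemma range_comb_powers:
  assumes "act P e = 0" "degree P > 0"
  shows "range (comb (map (\<lambda>i. (u ^^ i) e) [0..<degree P])) = range (\<lambda>f. act f e)"
proof
  show "range (comb (map (\<lambda>i. (u ^^ i) e) [0..<degree P])) \<subseteq> range (\<lambda>f. act f e)"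
  proof
    fix x assume "x \<in> range (comb (map (\<lambda>i. (u ^^ i) e) [0..<degree P]))"
    then obtain c where "x = comb (map (\<lambda>i. (u ^^ i) e) [0..<degree P]) c" by blast
    then have "x = act (\<Sum>i<degree P. monom (c i) i) e"
      by (simp add: comb_def act_sum act_monom)
    then show "x \<in> range (\<lambda>f. act f e)" by simp
  qed
  show "range (\<lambda>f. act f e) \<subseteq> range (comb (map (\<lambda>i. (u ^^ i) e) [0..<degree P]))"
  proof
    fix x assume "x \<in> range (\<lambda>f. act f e)"
    then obtain f where "x = act (f div P * P + f mod P) e" by auto
    then have "x = act (f mod P) e" by (simp only: act_add act_mult assms(1)) simp
    moreover have "degree (f mod P) < degree P" using assms(2) by (rule degree_mod_less_pos)
    ultimately show "x \<in> range (comb (map (\<lambda>i. (u ^^ i) e) [0..<degree P]))"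
      using act_eq_comb_powers by simp
  qed
qed

lemma act_monic:
  assumes "lead_coeff P = 1"
  shows "act P e = comb (map (\<lambda>i. (u ^^ i) e) [0..<degree P]) (coeff P) + (u ^^ degree P) e"
proof -
  have "act P e = (\<Sum>i<Suc (degree P). coeff P i *s (u ^^ i) e)"
    unfolding lessThan_Suc_atMost by (rule act_eq_sum) simp
  then show ?thesis using assms by (simp add: comb_def)
qed

text \<open>The columns of the companion matrix say that the basis vectors are the iterates of the first one, \<open>e\<close>, and
  that \<open>P\<close> kills \<open>e\<close>; independence of the iterates then makes \<open>P\<close> the annihilator.\<close>

lemma represented_on_companion:
  assumes P: "lead_coeff P = 1" "degree P > 0"
  shows "represented_on scale Z u (companion_mat P) \<longleftrightarrow> cyclic Z P"
proof
  let ?d = "degree P"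
  assume "represented_on scale Z u (companion_mat P)"
  then obtain bs where bs: "list_basis bs Z" "companion_mat P \<in> carrier_mat (length bs) (length bs)"
    "\<forall>j<length bs. u (bs ! j) = comb bs (\<lambda>i. companion_mat P $$ (i, j))"
    unfolding represented_on_iff by blast
  have len: "length bs = ?d" using bs(2) by (auto simp: companion_mat_def)
  define e where "e = bs ! 0"
  have step: "u (bs ! j) = bs ! Suc j" if "Suc j < ?d" for j
  proof -
    have "comb bs (\<lambda>i. companion_mat P $$ (i, j)) = comb bs (\<lambda>i. if i = Suc j then 1 else 0)"
      using that len by (intro comb_cong) (simp add: companion_mat_def)
    then show ?thesis using bs(3) that len by (simp add: comb_unit)
  qed
  have pow: "bs ! j = (u ^^ j) e" if "j < ?d" for j
    using that
  proof (induction j)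
    case (Suc j)
    then show ?case using step[of j] by simp
  qed (simp add: e_def)
  have bs_eq: "bs = map (\<lambda>i. (u ^^ i) e) [0..<?d]"
    by (rule nth_equalityI) (simp_all add: len pow)
  have "(u ^^ ?d) e = u (bs ! (?d - 1))" using pow[of "?d - 1"] P(2) by (cases ?d) simp_all
  also have "\<dots> = comb bs (\<lambda>i. - coeff P i)"
  proof -
    have "comb bs (\<lambda>i. companion_mat P $$ (i, ?d - 1)) = comb bs (\<lambda>i. - coeff P i)"
      using len P(2) by (intro comb_cong) (simp add: companion_mat_def)
    then show ?thesis using bs(3) len P(2) by simp
  qed
  finally have killed: "act P e = 0"
    using act_monic[OF P(1), of e] by (simp add: comb_minus bs_eq)
  have "annihilator e P"
    unfolding annihilator_def
  proof (intro conjI allI iffI)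
    show "lead_coeff P = 1" by fact
    fix f
    show "act f e = 0" if dvd: "P dvd f"
    proof -
      obtain k where "f = P * k" using dvd by (rule dvdE)
      then have "f = k * P" by (simp only: mult.commute)
      then show ?thesis by (simp add: act_mult killed)
    qed
    show "P dvd f" if f: "act f e = 0"
    proof -
      have "act (f div P * P + f mod P) e = 0" using f by simp
      then have r: "act (f mod P) e = 0" by (simp only: act_add act_mult killed) simp
      have deg: "degree (f mod P) < ?d" using P(2) by (rule degree_mod_less_pos)
      have "comb bs (coeff (f mod P)) = 0"
        using r act_eq_comb_powers[OF deg, of e] by (simp add: bs_eq)
      then have "coeff (f mod P) i = 0" if "i < ?d" for i
        using bs(1) that len by (auto simp: list_basis_def)
      then have "lead_coeff (f mod P) = 0" using deg by blast
      then show ?thesis by (simp add: dvd_eq_mod_eq_0)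
    qed
  qed
  moreover have "Z = range (\<lambda>f. act f e)"
    using bs(1) range_comb_powers[OF killed P(2)] by (simp add: list_basis_def bs_eq)
  ultimately show "cyclic Z P" using P(2) by (auto simp: cyclic_def)
next
  let ?d = "degree P"
  assume "cyclic Z P"
  then obtain e where e: "annihilator e P" "Z = range (\<lambda>f. act f e)" by (auto simp: cyclic_def)
  have killed: "act P e = 0" using e(1) by (simp add: annihilator_def)
  define bs where "bs = map (\<lambda>i. (u ^^ i) e) [0..<?d]"
  have len: "length bs = ?d" by (simp add: bs_def)
  have "list_basis bs Z"
    unfolding list_basis_def
  proof (intro conjI allI impI)
    show "range (comb bs) = Z" using range_comb_powers[OF killed P(2)] e(2) by (simp add: bs_def)
    show "c i = 0" if "comb bs c = 0" "i < length bs" for c i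
      using powers_relation_trivial[OF e(1), of c i] that by (simp add: comb_def bs_def)
  qed
  moreover have "companion_mat P \<in> carrier_mat (length bs) (length bs)"
    by (simp add: companion_mat_def len)
  moreover have "u (bs ! j) = comb bs (\<lambda>i. companion_mat P $$ (i, j))" if "j < length bs" for j
  proof (cases "Suc j < ?d")
    case True
    have "comb bs (\<lambda>i. companion_mat P $$ (i, j)) = comb bs (\<lambda>i. if i = Suc j then 1 else 0)"
      using True len by (intro comb_cong) (simp add: companion_mat_def)
    then show ?thesis using True len by (simp add: comb_unit bs_def)
  next
    case False
    then have j: "Suc j = ?d" using that len by simp
    have "comb bs (\<lambda>i. companion_mat P $$ (i, j)) = comb bs (\<lambda>i. - coeff P i)"
      using j len by (intro comb_cong) (simp add: companion_mat_def)
    also have "\<dots> = (u ^^ ?d) e"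
      using act_monic[OF P(1), of e] killed by (simp add: comb_minus bs_def neg_eq_iff_add_eq_0)
    also have "\<dots> = u (bs ! j)"
    proof -
      have "bs ! j = (u ^^ j) e" using that by (simp add: bs_def)
      then show ?thesis by (simp flip: j)
    qed
    finally show ?thesis by simp
  qed
  ultimately show "represented_on scale Z u (companion_mat P)" unfolding represented_on_iff by blast
qed

lemma represented_on_companion_blocks:
  assumes "\<forall>P\<in>set Ps. lead_coeff P = 1 \<and> degree P > 0"
  shows "represented_on scale W u (diag_block_mat (map companion_mat Ps)) \<longleftrightarrow> cyclic_decomposition W Ps"
  using assms
proof (induction Ps arbitrary: W)
  case Nil
  have "represented_on scale W u (0\<^sub>m 0 0) \<longleftrightarrow> list_basis [] W" unfolding represented_on_iff by auto
  also have "\<dots> \<longleftrightarrow> W = {0}" by (auto simp: list_basis_def comb_def)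
  finally show ?case by simp
next
  case (Cons P Ps)
  let ?B = "diag_block_mat (map companion_mat Ps)"
  have P: "lead_coeff P = 1" "degree P > 0" using Cons.prems by simp_all
  have IH: "represented_on scale C u ?B \<longleftrightarrow> cyclic_decomposition C Ps" for C
    using Cons.prems by (intro Cons.IH) simp
  have A: "companion_mat P \<in> carrier_mat (degree P) (degree P)" by (simp add: companion_mat_def)
  have "square_mat ?B" by (rule diag_block_mat_square) (auto simp: companion_mat_def)
  then have B: "?B \<in> carrier_mat (dim_row ?B) (dim_row ?B)" by auto
  have dims: "dim_row (companion_mat P) = degree P" "dim_col (companion_mat P) = degree P"
    by (simp_all add: companion_mat_def)
  have col: "dim_col ?B = dim_row ?B" using B by (rule carrier_matD(2))
  have blocks: "diag_block_mat (map companion_mat (P # Ps)) =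
    four_block_mat (companion_mat P) (0\<^sub>m (degree P) (dim_row ?B)) (0\<^sub>m (dim_row ?B) (degree P)) ?B"
    by (simp only: list.map diag_block_mat.simps Let_def dims col)
  have "represented_on scale W u (diag_block_mat (map companion_mat (P # Ps))) \<longleftrightarrow>
    (\<exists>Z C. direct_sum W Z C \<and> represented_on scale Z u (companion_mat P) \<and> represented_on scale C u ?B)"
    unfolding blocks by (rule represented_on_block_diag[OF A B])
  also have "\<dots> \<longleftrightarrow> cyclic_decomposition W (P # Ps)"
    unfolding represented_on_companion[OF P] IH by auto
  finally show ?case .
qed

text \<open>This replaces matrices by subspaces; monicity and positive degree of the factors are implied by their
  role as annihilators of generators of nonzero cyclic subspaces.\<close>

lemma elementary_factors_iff:
  "elementary_factors scale W u Ps \<longleftrightarrow>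
    (\<forall>i. Suc i < length Ps \<longrightarrow> Ps ! i dvd Ps ! Suc i) \<and> cyclic_decomposition W Ps"
proof -
  have "\<forall>P\<in>set Ps. lead_coeff P = 1 \<and> degree P > 0" if dec: "cyclic_decomposition W Ps"
  proof
    fix P assume P: "P \<in> set Ps"
    obtain Z where "cyclic Z P" using cyclic_decomposition_summand[OF dec P] by blast
    then show "lead_coeff P = 1 \<and> degree P > 0" by (auto simp: cyclic_def annihilator_def)
  qed
  then show ?thesis unfolding elementary_factors_def using represented_on_companion_blocks by blast
qed

end

section \<open>The commutation relation\<close>

locale char_two_endomorphism = endomorphism scale Basis u
  for scale :: "'k::field \<Rightarrow> 'v::ab_group_add \<Rightarrow> 'v" (infixr \<open>*s\<close> 75) and Basis u +
  fixes \<alpha> :: 'k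
  assumes char: "(2::'k) = 0" and \<alpha>_nonzero: "\<alpha> \<noteq> 0"
begin

text \<open>The polynomial whose value at \<open>u\<close> is the commutator \<open>u p + p u\<close>. The first linear factor is written with
  root \<open>0\<close> to expose both roots in the same form.\<close>

definition comm_poly :: "'k poly" where
  "comm_poly = Polynomial.smult (inverse \<alpha>) ([:- 0, 1:] * [:- \<alpha>, 1:])"

lemma scalar_add_self: "(x::'k) + x = 0"
  using char by (metis mult_2 mult_zero_left)

lemma vector_add_self: "(v::'v) + v = 0"
proof -
  have "v + v = (1 + 1) *s v" by (simp only: scale_left_distrib scale_one)
  then show ?thesis by (simp add: scalar_add_self)
qed

lemma scalar_minus: "- x = (x::'k)"
  using scalar_add_self by (simp add: minus_unique)

lemma act_comm_poly: "act comm_poly v = inverse \<alpha> *s u (u v) + u v"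
  using \<alpha>_nonzero
  by (simp add: comm_poly_def act_smult u_zero u_add u_scale scalar_minus scale_right_distrib add.commute)

lemma pderiv_comm_poly: "pderiv comm_poly = 1"
proof -
  have "pderiv comm_poly = Polynomial.smult (inverse \<alpha>) ([:- \<alpha>:] + (monom 1 1 + monom 1 1))"
    by (simp add: comm_poly_def pderiv_smult pderiv_mult pderiv_pCons monom_Suc monom_0)
  also have "\<dots> = 1"
    using \<alpha>_nonzero by (simp only: char_two_poly_add_self[OF char]) (simp add: scalar_minus one_pCons)
  finally show ?thesis .
qed

lemma poly_comm_poly_roots: "c \<in> {0, \<alpha>} \<Longrightarrow> poly comm_poly c = 0"
  by (auto simp: comm_poly_def)

text \<open>Given \<open>p\<close>, the second idempotent can only be \<open>q = p + \<alpha>\<inverse> u\<close>, and \<open>q\<close> is idempotent exactly when \<open>p\<close> satisfies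
  the commutation relation.\<close>

lemma composite_iff:
  "composite scale \<alpha> (- \<alpha>) u \<longleftrightarrow>
    (\<exists>p. Vector_Spaces.linear scale scale p \<and> p \<circ> p = p \<and> (\<forall>v. u (p v) + p (u v) = act comm_poly v))"
proof
  assume "composite scale \<alpha> (- \<alpha>) u"
  then obtain p q where p: "Vector_Spaces.linear scale scale p" "p \<circ> p = p"
    and q: "Vector_Spaces.linear scale scale q" "q \<circ> q = q"
    and u: "u = (\<lambda>v. \<alpha> *s p v + (- \<alpha>) *s q v)"
    unfolding composite_def by blast
  have pp: "p (p v) = p v" and qq: "q (q v) = q v" for v
    using p(2) q(2) by (metis comp_apply)+
  have p_add: "p (v + w) = p v + p w" and p_scale: "p (c *s v) = c *s p v" for v w c
    using p(1) by (simp_all add: Vector_Spaces.linear_iff)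
  have q_add: "q (v + w) = q v + q w" and q_scale: "q (c *s v) = c *s q v" for v w c
    using q(1) by (simp_all add: Vector_Spaces.linear_iff)
  have uv: "u v = \<alpha> *s (p v + q v)" for v
    by (subst u) (simp add: scalar_minus scale_right_distrib)
  have inv: "inverse \<alpha> * \<alpha> = 1" using \<alpha>_nonzero by simp
  have "u (p v) + p (u v) = act comm_poly v" for v
  proof -
    have "u (p v) + p (u v) = \<alpha> *s ((p v + p v) + (q (p v) + p (q v)))"
      by (simp add: uv p_add p_scale pp scale_right_distrib add_ac)
    moreover have "act comm_poly v = \<alpha> *s ((p v + p v) + (q (p v) + p (q v)) + (q v + q v))"
      by (simp add: inv mult.assoc[symmetric] act_comm_poly uv p_add p_scale q_add q_scale pp qq scale_right_distrib add_ac)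
    ultimately show ?thesis by (simp add: vector_add_self)
  qed
  then show "\<exists>p. Vector_Spaces.linear scale scale p \<and> p \<circ> p = p \<and> (\<forall>v. u (p v) + p (u v) = act comm_poly v)"
    using p by blast
next
  assume "\<exists>p. Vector_Spaces.linear scale scale p \<and> p \<circ> p = p \<and> (\<forall>v. u (p v) + p (u v) = act comm_poly v)"
  then obtain p where p: "Vector_Spaces.linear scale scale p" "p \<circ> p = p"
    and comm: "\<And>v. u (p v) + p (u v) = act comm_poly v" by blast
  have pp: "p (p v) = p v" for v using p(2) by (metis comp_apply)
  have p_add: "p (v + w) = p v + p w" and p_scale: "p (c *s v) = c *s p v" for v w c
    using p(1) by (simp_all add: Vector_Spaces.linear_iff)
  define q where "q v = p v + inverse \<alpha> *s u v" for v
  have "Vector_Spaces.linear scale scale q"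
    using p(1) linear_u unfolding q_def
    by (auto simp: Vector_Spaces.linear_iff scale_right_distrib scale_left_commute add_ac)
  moreover have "q \<circ> q = q"
  proof
    fix v
    have "q (q v) = inverse \<alpha> *s (inverse \<alpha> *s u (u v)) + inverse \<alpha> *s (u (p v) + p (u v)) + p v"
      by (simp add: q_def p_add p_scale pp u_add u_scale scale_right_distrib add_ac)
    also have "\<dots> = (inverse \<alpha> *s (inverse \<alpha> *s u (u v)) + inverse \<alpha> *s (inverse \<alpha> *s u (u v))) + q v"
      unfolding comm act_comm_poly by (simp add: q_def scale_right_distrib add_ac)
    finally show "(q \<circ> q) v = q v" by (simp add: vector_add_self)
  qed
  moreover have "u = (\<lambda>v. \<alpha> *s p v + (- \<alpha>) *s q v)"
  proof
    fix v
    have "\<alpha> *s p v + (- \<alpha>) *s q v = (\<alpha> *s p v + \<alpha> *s p v) + u v"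
      using \<alpha>_nonzero by (simp add: q_def scalar_minus scale_right_distrib add.assoc)
    then show "u v = \<alpha> *s p v + (- \<alpha>) *s q v" by (simp add: vector_add_self)
  qed
  ultimately show "composite scale \<alpha> (- \<alpha>) u" using p unfolding composite_def by blast
qed

text \<open>The commutator with \<open>p\<close> is a derivation on the polynomials in \<open>u\<close>, determined by its value
  \<open>comm_poly\<close> at \<open>u\<close>. Signs disappear in characteristic 2.\<close>

lemma act_commutator:
  assumes p: "Vector_Spaces.linear scale scale p" and comm: "\<And>v. u (p v) + p (u v) = act comm_poly v"
  shows "act f (p v) + p (act f v) = act (pderiv f * comm_poly) v"
proof (induction f arbitrary: v)
  case 0
  have "p 0 = 0" using p by (metis Vector_Spaces.linear_iff scale_zero_left)
  then show ?case by simp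
next
  case (pCons a f)
  have p_add: "p (v + w) = p v + p w" and p_scale: "p (c *s v) = c *s p v" for v w c
    using p by (simp_all add: Vector_Spaces.linear_iff)
  have "act (pCons a f) (p v) + p (act (pCons a f) v) =
    (a *s p v + a *s p v) + (u (act f (p v)) + p (u (act f v)))"
    by (simp add: p_add p_scale add_ac)
  also have "\<dots> = u (act f (p v)) + p (u (act f v)) + (u (p (act f v)) + u (p (act f v)))"
    by (simp only: vector_add_self add_0 add_0_right)
  also have "\<dots> = u (act f (p v) + p (act f v)) + (u (p (act f v)) + p (u (act f v)))"
    by (simp add: u_add add_ac)
  also have "\<dots> = u (act (pderiv f * comm_poly) v) + act comm_poly (act f v)"
    by (simp only: pCons.IH comm)
  also have "\<dots> = act (pCons 0 (pderiv f) * comm_poly + comm_poly * f) v"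
    by (simp add: act_add act_mult)
  also have "pCons 0 (pderiv f) * comm_poly + comm_poly * f = pderiv (pCons a f) * comm_poly"
    by (simp add: pderiv_pCons algebra_simps)
  finally show ?case .
qed

text \<open>The vector \<open>p e\<close> may leave the kernel of \<open>Q\<close>; multiplying by the product of the linear factors brings it
  back, and this costs only factors that are coprime to \<open>P\<close>.\<close>

lemma summand_pderiv_eq_0:
  assumes p: "Vector_Spaces.linear scale scale p" and comm: "\<And>v. u (p v) + p (u v) = act comm_poly v"
    and M: "set_mset M \<subseteq> {0, \<alpha>}" and Q: "\<And>c. c \<in> {0, \<alpha>} \<Longrightarrow> poly Q c \<noteq> 0"
    and kills: "\<And>v. act ((\<Prod>c\<in>#M. [:- c, 1:]) * Q) v = 0"
    and dec: "cyclic_decomposition {v. act Q v = 0} Ps" "P \<in> set Ps"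
  shows "pderiv P = 0"
proof -
  let ?W = "{v. act Q v = 0}" and ?H = "\<Prod>c\<in>#M. [:- c, 1:]"
  obtain Z C where Z: "cyclic Z P" and C: "invariant C" and ds: "direct_sum ?W Z C"
    using cyclic_decomposition_summand[OF dec] by blast
  obtain e where e: "annihilator e P" and Z_eq: "Z = range (\<lambda>f. act f e)"
    using Z by (auto simp: cyclic_def)
  have ann: "act f e = 0 \<longleftrightarrow> P dvd f" for f using e by (simp add: annihilator_def)
  \<comment> \<open>\<open>P\<close> kills the generator, hence all of \<open>Z\<close>.\<close>
  have Z_zero: "act P z = 0" if "z \<in> Z" for z
    using that ann[of P] act_commute[of P _ e] by (auto simp: Z_eq)
  have "P dvd Q" using cyclic_decomposition_dvd[OF dec, of Q] by simp
  then have P_roots: "poly P c \<noteq> 0" if "c \<in> {0, \<alpha>}" for c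
    using Q[OF that] by (auto simp: dvd_def)
  \<comment> \<open>Multiplication by the product of the linear factors brings \<open>p e\<close> into the kernel of \<open>Q\<close>.\<close>
  have "act Q (act ?H (p e)) = 0"
    using kills[of "p e"] by (simp only: mult.commute[of ?H] act_mult)
  then have "act ?H (p e) \<in> {z + c |z c. z \<in> Z \<and> c \<in> C}"
    using ds unfolding direct_sum_def by blast
  then obtain z c where zc: "act ?H (p e) = z + c" "z \<in> Z" "c \<in> C" by blast
  have "p 0 = 0" using p by (metis Vector_Spaces.linear_iff scale_zero_left)
  then have "act P (p e) = act (pderiv P * comm_poly) e"
    using act_commutator[OF p comm, of P e] ann[of P] by simp
  then have "act P (act ?H (p e)) = act (?H * (pderiv P * comm_poly)) e"
    by (simp only: act_commute[of P ?H] act_mult[of ?H])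
  moreover have "act P (act ?H (p e)) = act P c"
    unfolding zc(1) act_vector_add using Z_zero[OF zc(2)] by simp
  ultimately have eq: "act (?H * (pderiv P * comm_poly)) e = act P c" by simp
  have "act (?H * (pderiv P * comm_poly)) e \<in> C" unfolding eq using invariant_act[OF C zc(3)] .
  moreover have "act (?H * (pderiv P * comm_poly)) e \<in> Z" unfolding Z_eq by (rule rangeI)
  moreover have "Z \<inter> C = {0}" using ds unfolding direct_sum_def by (rule conjunct2)
  ultimately have "act (?H * (pderiv P * comm_poly)) e = 0" by (metis IntI singletonD)
  then have "P dvd ?H * (pderiv P * comm_poly)" by (simp only: ann)
  then have "P dvd pderiv P * comm_poly"
    by (rule dvd_linear_factors_cancel) (use M P_roots in blast)
  moreover have "pderiv P * comm_poly = Polynomial.smult (inverse \<alpha>) ([:- 0, 1:] * ([:- \<alpha>, 1:] * pderiv P))"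
    unfolding comm_poly_def mult_smult_right mult.assoc by (simp only: mult.left_commute mult.commute)
  ultimately have "P dvd [:- 0, 1:] * ([:- \<alpha>, 1:] * pderiv P)"
    using \<alpha>_nonzero dvd_smult_cancel[of P "inverse \<alpha>"] by (metis inverse_nonzero_iff_nonzero)
  then have "P dvd [:- \<alpha>, 1:] * pderiv P" by (rule dvd_linear_cancel) (rule P_roots, simp)
  then have "P dvd pderiv P" by (rule dvd_linear_cancel) (rule P_roots, simp)
  then show ?thesis by (rule pderiv_eq_0_if_dvd)
qed

section \<open>Construction of the idempotent\<close>

text \<open>The partial map \<open>p\<close> of the commutation relation on a subspace. Linearity is
  required on \<open>W\<close> alone, so that maps on the summands of a direct sum can be glued as they are.\<close>

definition admits_idempotent :: "'v set \<Rightarrow> bool" where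
  "admits_idempotent W \<longleftrightarrow> (\<exists>p. (\<forall>v\<in>W. p v \<in> W \<and> p (p v) = p v \<and> u (p v) + p (u v) = act comm_poly v) \<and>
    (\<forall>v\<in>W. \<forall>w\<in>W. p (v + w) = p v + p w) \<and> (\<forall>v\<in>W. \<forall>c. p (c *s v) = c *s p v))"

text \<open>Identify the cyclic subspace with \<open>K[X]/(P)\<close> and put \<open>T f = f + g f'\<close> for \<open>g = comm_poly\<close>. The hypothesis makes \<open>T\<close>
  preserve the multiples of \<open>P\<close>, by \<open>T (P k) = P (k + g k') + g P' k\<close>. Idempotence comes from \<open>g' = 1\<close> and \<open>f'' = 0\<close>, which
  give \<open>(T f)' = 0\<close>; the commutation relation comes from \<open>T (X f) = X (T f) + g f\<close>.\<close>

lemma admits_idempotent_cyclic: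
  assumes Z: "cyclic Z P" and P: "P dvd comm_poly * pderiv P"
  shows "admits_idempotent Z"
proof -
  obtain e where e: "annihilator e P" and Z_eq: "Z = range (\<lambda>f. act f e)"
    using Z by (auto simp: cyclic_def)
  have ann: "act f e = 0 \<longleftrightarrow> P dvd f" for f using e by (simp add: annihilator_def)
  define T where "T f = f + comm_poly * pderiv f" for f
  define p where "p v = act (T (SOME f. v = act f e)) e" for v
  have T_add: "T (f + h) = T f + T h" for f h by (simp add: T_def pderiv_add algebra_simps)
  have T_smult: "T (Polynomial.smult c f) = Polynomial.smult c (T f)" for c f
    by (simp add: T_def pderiv_smult smult_add_right)
  have T_dvd: "P dvd T f" if "P dvd f" for f
  proof -
    from that obtain k where "f = P * k" by (rule dvdE)
    then have "T f = P * k + comm_poly * pderiv P * k + P * (comm_poly * pderiv k)"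
      by (simp add: T_def pderiv_mult algebra_simps)
    then show ?thesis using P by simp
  qed
  have p_act: "p (act f e) = act (T f) e" for f
  proof -
    define h where "h = (SOME h. act f e = act h e)"
    have "act f e = act h e" unfolding h_def by (rule someI) (rule refl)
    then have "act (h - f) e = 0" by (simp add: act_diff)
    then have "act (T (h - f)) e = 0" using T_dvd by (simp add: ann)
    moreover have "T h = T (h - f) + T f" by (simp flip: T_add)
    ultimately show ?thesis unfolding p_def h_def[symmetric] by (simp add: act_add)
  qed
  have T_idem: "T (T f) = T f" for f
  proof -
    have "pderiv (T f) = pderiv f + pderiv f"
      by (simp add: T_def pderiv_add pderiv_mult pderiv_comm_poly char_two_pderiv_pderiv[OF char])
    then show ?thesis using char_two_poly_add_self[OF char] T_def[of "T f"] by simp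
  qed
  have T_comm: "pCons 0 (T f) + T (pCons 0 f) = comm_poly * f" for f
  proof -
    have "pCons 0 (T f) + T (pCons 0 f) = (pCons 0 f + pCons 0 f)
        + (comm_poly * pCons 0 (pderiv f) + comm_poly * pCons 0 (pderiv f)) + comm_poly * f"
      by (simp add: T_def pderiv_pCons algebra_simps)
    then show ?thesis by (simp only: char_two_poly_add_self[OF char] add_0)
  qed
  show ?thesis
    unfolding admits_idempotent_def
  proof (intro exI[of _ p] conjI ballI allI)
    fix v assume "v \<in> Z"
    then obtain f where v: "v = act f e" by (auto simp: Z_eq)
    show "p v \<in> Z" by (simp add: v p_act Z_eq)
    show "p (p v) = p v" by (simp add: v p_act T_idem)
    have "u (p v) + p (u v) = act (pCons 0 (T f)) e + p (act (pCons 0 f) e)"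
      by (simp add: v p_act)
    also have "\<dots> = act comm_poly v" by (simp only: p_act v T_comm act_mult flip: act_add)
    finally show "u (p v) + p (u v) = act comm_poly v" .
    show "p (c *s v) = c *s p v" for c
      using p_act[of "Polynomial.smult c f"] by (simp add: v act_smult T_smult p_act)
    fix w assume "w \<in> Z"
    then obtain h where w: "w = act h e" by (auto simp: Z_eq)
    show "p (v + w) = p v + p w"
      using p_act[of "f + h"] by (simp add: v w act_add T_add p_act)
  qed
qed

text \<open>Apply the two maps componentwise; the component in \<open>Z\<close> of a vector of \<open>W\<close> is unique, so
  additivity and homogeneity carry over.\<close>

lemma admits_idempotent_direct_sum:
  assumes ds: "direct_sum W Z C" and inv: "invariant Z" "invariant C"
    and Z: "admits_idempotent Z" and C: "admits_idempotent C"
  shows "admits_idempotent W"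
proof -
  obtain pz where pz: "\<And>v. v \<in> Z \<Longrightarrow> pz v \<in> Z \<and> pz (pz v) = pz v \<and> u (pz v) + pz (u v) = act comm_poly v"
    "\<And>v w. v \<in> Z \<Longrightarrow> w \<in> Z \<Longrightarrow> pz (v + w) = pz v + pz w" "\<And>v c. v \<in> Z \<Longrightarrow> pz (c *s v) = c *s pz v"
    using Z unfolding admits_idempotent_def by blast
  obtain pc where pc: "\<And>v. v \<in> C \<Longrightarrow> pc v \<in> C \<and> pc (pc v) = pc v \<and> u (pc v) + pc (u v) = act comm_poly v"
    "\<And>v w. v \<in> C \<Longrightarrow> w \<in> C \<Longrightarrow> pc (v + w) = pc v + pc w" "\<And>v c. v \<in> C \<Longrightarrow> pc (c *s v) = c *s pc v"
    using C unfolding admits_idempotent_def by blast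
  have sub: "subspace Z" "subspace C" and u_in: "\<And>z. z \<in> Z \<Longrightarrow> u z \<in> Z" "\<And>c. c \<in> C \<Longrightarrow> u c \<in> C"
    using inv by (simp_all add: invariant_def)
  define r where "r v = (SOME z. z \<in> Z \<and> v - z \<in> C)" for v
  define p where "p v = pz (r v) + pc (v - r v)" for v
  have p: "p (z + c) = pz z + pc c" if zc: "z \<in> Z" "c \<in> C" for z c
  proof -
    have "r (z + c) \<in> Z \<and> z + c - r (z + c) \<in> C"
      unfolding r_def by (rule someI[of _ z]) (simp add: zc)
    then have r: "r (z + c) \<in> Z" "z + c - r (z + c) \<in> C" by simp_all
    have "r (z + c) + (z + c - r (z + c)) = z + c" by simp
    from direct_sum_unique[OF ds sub r(1) zc(1) r(2) zc(2) this]
    have "r (z + c) = z" "z + c - r (z + c) = c" .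
    then show ?thesis unfolding p_def by simp
  qed
  have W: "W = {z + c |z c. z \<in> Z \<and> c \<in> C}" using ds by (simp add: direct_sum_def)
  show ?thesis
    unfolding admits_idempotent_def
  proof (intro exI[of _ p] conjI ballI allI)
    fix v assume "v \<in> W"
    then obtain z c where v: "v = z + c" "z \<in> Z" "c \<in> C" by (auto simp: W)
    have zc: "pz z \<in> Z" "pc c \<in> C" using pz(1)[OF v(2)] pc(1)[OF v(3)] by simp_all
    show "p v \<in> W" unfolding W v(1) p[OF v(2,3)] using zc by blast
    show "p (p v) = p v" using v pz(1) pc(1) by (simp add: p zc)
    have "u (p v) + p (u v) = (u (pz z) + pz (u z)) + (u (pc c) + pc (u c))"
      unfolding v(1) u_add p[OF v(2,3)] p[OF u_in(1)[OF v(2)] u_in(2)[OF v(3)]]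
      by (simp only: add_ac)
    then show "u (p v) + p (u v) = act comm_poly v"
      using pz(1)[OF v(2)] pc(1)[OF v(3)] by (simp add: v(1) act_vector_add)
    show "p (a *s v) = a *s p v" for a
      using p[of "a *s z" "a *s c"] v pz(3) pc(3) sub
      by (simp add: p scale_right_distrib subspace_scale)
    fix w assume "w \<in> W"
    then obtain z' c' where w: "w = z' + c'" "z' \<in> Z" "c' \<in> C" by (auto simp: W)
    have "v + w = (z + z') + (c + c')" by (simp add: v w add_ac)
    moreover have "z + z' \<in> Z" "c + c' \<in> C" using v w sub by (simp_all add: subspace_add)
    ultimately have "p (v + w) = pz (z + z') + pc (c + c')" by (simp only: p)
    moreover have "p v = pz z + pc c" "p w = pz z' + pc c'" using v w by (simp_all add: p)
    ultimately show "p (v + w) = p v + p w" using v(2,3) w(2,3) by (simp add: pz(2) pc(2) add_ac)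
  qed
qed

lemma admits_idempotent_cyclic_decomposition:
  assumes "cyclic_decomposition W Ps" "\<And>P. P \<in> set Ps \<Longrightarrow> P dvd comm_poly * pderiv P"
  shows "admits_idempotent W"
  using assms
proof (induction Ps arbitrary: W)
  case Nil
  then show ?case unfolding admits_idempotent_def by (intro exI[of _ "\<lambda>v. 0"]) (simp add: u_zero)
next
  case (Cons P Ps)
  then obtain Z C where ZC: "cyclic Z P" "cyclic_decomposition C Ps" "direct_sum W Z C" by auto
  show ?case
  proof (rule admits_idempotent_direct_sum[OF ZC(3)])
    show "admits_idempotent Z" by (rule admits_idempotent_cyclic[OF ZC(1)]) (rule Cons.prems(2), simp)
    show "admits_idempotent C" by (rule Cons.IH[OF ZC(2)]) (rule Cons.prems(2), simp)
  qed (use ZC invariant_cyclic invariant_cyclic_decomposition in blast)+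
qed

lemma composite_if_admits_idempotent: 
  assumes "admits_idempotent UNIV" 
  shows "composite scale \<alpha> (- \<alpha>) u"
proof -
  obtain p where "\<And>v. p (p v) = p v" "\<And>v. u (p v) + p (u v) = act comm_poly v"
    "\<And>v w. p (v + w) = p v + p w" "\<And>v c. p (c *s v) = c *s p v"
    using assms unfolding admits_idempotent_def by blast
  then have "Vector_Spaces.linear scale scale p" "p \<circ> p = p"
    using linear_u by (auto simp: Vector_Spaces.linear_iff)
  then show ?thesis unfolding composite_iff using \<open>\<And>v. u (p v) + p (u v) = act comm_poly v\<close> by blast
qed

text \<open>The two terms of the Bezout identity, applied to a vector, are its components: each contains one of
  the factors, and the other factor then completes \<open>H Q\<close>.\<close>

lemma direct_sum_kernels:
  assumes "\<And>v. act (H * Q) v = 0" "a * Q + b * H = 1"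
  shows "direct_sum UNIV {v. act Q v = 0} {v. act H v = 0}"
proof -
  have split: "v = act (b * H) v + act (a * Q) v" for v
    using assms(2) by (metis act_add act_one add.commute)
  have "v \<in> {z + c |z c. z \<in> {v. act Q v = 0} \<and> c \<in> {v. act H v = 0}}" for v
  proof -
    have "act Q (act (b * H) v) = act b (act (H * Q) v)" "act H (act (a * Q) v) = act a (act (H * Q) v)"
      by (simp_all add: mult_ac flip: act_mult)
    then show ?thesis using split[of v] assms(1) by auto
  qed
  moreover have "v = 0" if "act Q v = 0" "act H v = 0" for v
    using split[of v] that by (simp add: act_mult)
  ultimately show ?thesis unfolding direct_sum_def by auto
qed

theorem composite_iff_even_factors:
  "composite scale \<alpha> (- \<alpha>) u \<longleftrightarrow>
    (\<forall>Ps. elementary_factors scale (part_without scale {0, \<alpha>} u) u Ps \<longrightarrow> (\<forall>P\<in>set Ps. even_poly P))"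
proof -
  let ?\<mu> = "minimal_poly scale u"
  define Q where "Q = remove_roots {0, \<alpha>} ?\<mu>"
  obtain M where M: "set_mset M \<subseteq> {0, \<alpha>}" and \<mu>: "?\<mu> = (\<Prod>c\<in>#M. [:- c, 1:]) * Q"
    and Q: "lead_coeff Q = 1" "\<And>c. c \<in> {0, \<alpha>} \<Longrightarrow> poly Q c \<noteq> 0"
    using remove_roots_decomposition[OF minimal_poly_properties(1), of "{0, \<alpha>}"] unfolding Q_def by metis
  let ?H = "\<Prod>c\<in>#M. [:- c, 1:]"
  have kills: "act (?H * Q) v = 0" for v
    using minimal_poly_properties(2)[of ?\<mu>] by (simp add: \<mu>)
  have W: "part_without scale {0, \<alpha>} u = {v. act Q v = 0}" by (simp add: part_without_def Q_def)
  show ?thesis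
  proof
    assume "composite scale \<alpha> (- \<alpha>) u"
    then obtain p where p: "Vector_Spaces.linear scale scale p" "\<And>v. u (p v) + p (u v) = act comm_poly v"
      unfolding composite_iff by blast
    show "\<forall>Ps. elementary_factors scale (part_without scale {0, \<alpha>} u) u Ps \<longrightarrow> (\<forall>P\<in>set Ps. even_poly P)"
      unfolding W elementary_factors_iff even_poly_iff_pderiv_eq_0[OF char]
      using summand_pderiv_eq_0[OF p M Q(2) kills] by blast
  next
    assume even: "\<forall>Ps. elementary_factors scale (part_without scale {0, \<alpha>} u) u Ps \<longrightarrow> (\<forall>P\<in>set Ps. even_poly P)"
    obtain Ps where Ps: "cyclic_decomposition {v. act Q v = 0} Ps"
      "\<And>i. Suc i < length Ps \<Longrightarrow> Ps ! i dvd Ps ! Suc i"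
      using cyclic_decomposition_exists[OF invariant_kernel[of Q]] by metis
    then have "elementary_factors scale (part_without scale {0, \<alpha>} u) u Ps"
      unfolding W elementary_factors_iff by blast
    then have "pderiv P = 0" if "P \<in> set Ps" for P
      using even that by (simp add: even_poly_iff_pderiv_eq_0[OF char])
    then have W_idem: "admits_idempotent {v. act Q v = 0}"
      by (intro admits_idempotent_cyclic_decomposition[OF Ps(1)]) simp
    obtain Rs where Rs: "cyclic_decomposition {v. act ?H v = 0} Rs"
      using cyclic_decomposition_exists[OF invariant_kernel[of ?H]] by metis
    have "R dvd comm_poly * pderiv R" if "R \<in> set Rs" for R
    proof (rule dvd_multiple_pderiv_if_linear_factors)
      show "R dvd ?H" using cyclic_decomposition_dvd[OF Rs that, of ?H] by simp
      show "poly comm_poly c = 0" if "c \<in># M" for c using that M poly_comm_poly_roots by blast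
    qed
    then have H_idem: "admits_idempotent {v. act ?H v = 0}"
      by (intro admits_idempotent_cyclic_decomposition[OF Rs])
    have "Q \<noteq> 0" using Q(1) by auto
    then obtain a b where "a * Q + b * ?H = 1" using linear_factors_bezout[of Q M] Q(2) M by blast
    then have "direct_sum UNIV {v. act Q v = 0} {v. act ?H v = 0}"
      by (rule direct_sum_kernels[OF kills])
    then have "admits_idempotent UNIV"
      by (rule admits_idempotent_direct_sum[OF _ invariant_kernel invariant_kernel W_idem H_idem])
    then show "composite scale \<alpha> (- \<alpha>) u" by (rule composite_if_admits_idempotent)
  qed
qed

end

theorem theorem6:
  fixes scale :: "'k::field \<Rightarrow> 'v::ab_group_add \<Rightarrow> 'v"
    and Basis :: "'v set" and n :: nat and \<alpha> :: 'k and u :: "'v \<Rightarrow> 'v"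
  assumes "CHAR('k) = 2"
    and "\<alpha> \<noteq> 0"
    and "finite_dimensional_vector_space scale Basis"
    and "vector_space.dim scale (UNIV :: 'v set) = n" and "n \<ge> 1"
    and "Vector_Spaces.linear scale scale u"
  shows "composite scale \<alpha> (- \<alpha>) u \<longleftrightarrow>
    (\<forall>Ps. elementary_factors scale (part_without scale {0, \<alpha>} u) u Ps
       \<longrightarrow> (\<forall>P\<in>set Ps. even_poly P))"
proof -
  have "(2::'k) = 0" using of_nat_CHAR[where 'a = 'k] assms(1) by simp
  then interpret char_two_endomorphism scale Basis u \<alpha>
    using assms
    by (intro char_two_endomorphism.intro endomorphism.intro endomorphism_axioms.intro
        char_two_endomorphism_axioms.intro)
  show ?thesis by (rule composite_iff_even_factors)
qed

end
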